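(* Let $N\ge1$, let $E\subset\mathfrak{LC}(\mathbb R^{2N},\mathbb R^N)$, and let $D'\subset\mathbb R^N$ and $D\subset\mathbb R^{2N}$ be any countable dense subsets. (i) Suppose $E$ has $L^1_{loc}$-equicontinuous $m$-bounds and $L^1_{loc}$-bounded $l_2$-bounds, and let $\Theta=\{\theta^I_j\}$ be the suitable set of moduli of continuity given by the $m$-bounds of $E$, i.e. $\theta^I_j(s)=\sup_{t\in I,\,f\in E}\int_t^{t+s}m^j_f(u)\,du$. For any sequence $(f_n)_{n\in\mathbb N}$ in $E$ converging to some $f$ in $(\mathfrak{LC}(\mathbb R^{2N},\mathbb R^N),\mathcal T_{\Theta D'})$ and any sequence $(\phi_n)_{n\in\mathbb N}$ in $\mathcal C^{1,1}$ converging uniformly to $\phi\in\mathcal C^{1,1}$, one has $$\|x(\cdot,f_n,\phi_n)-x(\cdot,f,\phi)\|_{\mathcal C^{1,1}([-1,T])}\xrightarrow{n\to\infty}0\qquad( * )$$ for any $[-1,T]\subset I_{f,\phi}$. (ii) If $E$ has $L^1_{loc}$-bounded $l$-bounds, then $( * )$ holds when the convergence of the sequence $(f_n)_{n\in\mathbb N}$ to $f$ is with respect to $\mathcal T_D$.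
   Context: $B_j$ is the closed ball of radius $j$ centered at the origin; $C(I,W)$ is the space of continuous functions $I\to W$. $L^1_{loc}$ is the set of real functions on $\mathbb R$ belonging to $L^1(I)$ for every compact interval $I$. For a compact interval $I$, $\mathcal C^{1,1}(I)$ is the space of continuous functions $x:I\to\mathbb R^N$ which are differentiable a.e. and satisfy $\dot x\in L^1(I)$, normed by $\|x\|_{\mathcal C^{1,1}(I)}=\|x\|_{L^\infty(I)}+\|\dot x\|_{L^1(I)}$; $\mathcal C^{1,1}=\mathcal C^{1,1}([-1,0])$. $\mathfrak{LC}(\mathbb R^{2N},\mathbb R^N)$ is the set of functions $f:\mathbb R\times\mathbb R^{2N}\to\mathbb R^N$ such that: $f$ is Borel measurable; for every compact $K\subset\mathbb R^{2N}$ there are $m^K,l^K\in L^1_{loc}$ such that for a.e. $t\in\mathbb R$, $|f(t,z)|\le m^K(t)$ and $|f(t,z_1)-f(t,z_2)|\le l^K(t)|z_1-z_2|$ for all $z,z_1,z_2\in K$. Functions differing only on a negligible set are identified. Points of $\mathbb R^{2N}$ are written $(x,u)$. Optimal bounds of $f$ on $B_j\subset\mathbb R^{2N}$: $m^j_f(t)=\sup_{z\in B_j}|f(t,z)|$, $l^j_f(t)=\sup_{z_1\neq z_2\in B_j}|f(t,z_1)-f(t,z_2)|/|z_1-z_2|$, $l^j_{2,f}(t)=\sup|f(t,x,u_1)-f(t,x,u_2)|/|u_1-u_2|$ over $(x,u_1),(x,u_2)\in B_j$, $u_1\ne u_2$. $E$ has $L^1_{loc}$-equicontinuous $m$-bounds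 if for every $j\in\mathbb N$, $r,\varepsilon>0$ there is $\delta>0$ with $\sup_{f\in E}\int_s^t m^j_f(u)\,du<\varepsilon$ whenever $-r\le s\le t\le r$, $t-s<\delta$. $E$ has $L^1_{loc}$-bounded $l$-bounds (resp. $l_2$-bounds) if $\sup_{f\in E}\int_{-r}^r l^j_f(t)\,dt<\infty$ (resp. $\sup_{f\in E}\int_{-r}^r l^j_{2,f}(t)\,dt<\infty$) for every $j\in\mathbb N$, $r>0$. A suitable set of moduli of continuity is a countable set $\{\theta^I_j: j\in\mathbb N,\ I=[q_1,q_2],\ q_1,q_2\in\mathbb Q\}$ of non-decreasing continuous functions $[0,\infty)\to[0,\infty)$ with $\theta^I_j(0)=0$ and $\theta^{I_1}_{j_1}\le\theta^{I_2}_{j_2}$ whenever $I_1\subseteq I_2$, $j_1\le j_2$. $\mathcal K^I_j$ is the set of $x\in C(I,B_j)$, $B_j\subset\mathbb R^N$, with $|x(t)-x(s)|\le\theta^I_j(|t-s|)$ for all $t,s\in I$. Topologies, generated by the following seminorms over all $I=[q_1,q_2]$, $q_1,q_2\in\mathbb Q$, $j\in\mathbb N$: - $\mathcal T_{\Theta D'}$: $\sup_{x\in\mathcal K^I_j}\int_I|f(t,x(t),u)|\,dt$, $u\in D'$; - $\mathcal T_D$: $\int_I|f(t,z)|\,dt$, $z\in D$. For $f\in\mathfrak{LC}(\mathbb R^{2N},\mathbb R^N)$ and $\phi\in C([-1,0],\mathbb R^N)$, $x(\cdot,f,\phi)$ denotes the unique maximal continuous (Carathéodory) solution, with maximal interval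 of definition $I_{f,\phi}=[-1,b_{f,\phi})$, of $\dot x=f(t,x(t),x(t-1))$ for $t>0$, $x(t)=\phi(t)$ for $t\in[-1,0]$; if $b_{f,\phi}<\infty$ then $|x(t,f,\phi)|\to\infty$ as $t\to b_{f,\phi}$. Convergence on $[-1,T]$ is understood for $n$ large enough that $[-1,T]\subset I_{f_n,\phi_n}$, this being part of the assertion.
   Formalization: Since φ_n→φ only uniformly makes ( * ) false (f=0, φ_n=sin(2πnt)/n), it is proved that the solutions converge uniformly on [-1,T] and in C^{1,1}([0,T]), and that ( * ) holds on [-1,T] whenever φ_n→φ in C^{1,1}. *)

theory Defs
  imports "HOL-Analysis.Analysis"
begin

definition L1_loc :: "(real \<Rightarrow> real) set" where
  "L1_loc = {m. \<forall>a b. m absolutely_integrable_on {a..b}}"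

(* Elements are representatives. Two representatives that are identified have distance 0 for
   every seminorm below and the same Caratheodory solutions, so no quotient is formed. *)
definition LC :: "(real \<Rightarrow> (real ^ 'n) \<times> (real ^ 'n) \<Rightarrow> real ^ 'n) set" where
  "LC = {f. (\<lambda>(t, z). f t z) \<in> borel_measurable borel \<and>
     (\<forall>K. compact K \<longrightarrow> (\<exists>m \<in> L1_loc. \<exists>l \<in> L1_loc. AE t in lebesgue.
        (\<forall>z\<in>K. norm (f t z) \<le> m t) \<and>
        (\<forall>z1\<in>K. \<forall>z2\<in>K. norm (f t z1 - f t z2) \<le> l t * norm (z1 - z2))))}"

(* The optimal bounds, their integrals and the seminorms are extended nonnegative reals, so that an
   infinite supremum or a divergent integral is the value infinity and never a default value. *)
definition m_bound :: "nat \<Rightarrow> (real \<Rightarrow> (real ^ 'n) \<times> (real ^ 'n) \<Rightarrow> real ^ 'n) \<Rightarrow> real \<Rightarrow> ennreal" where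
  "m_bound j f t = (SUP z \<in> cball 0 (real j). ennreal (norm (f t z)))"

definition l_bound :: "nat \<Rightarrow> (real \<Rightarrow> (real ^ 'n) \<times> (real ^ 'n) \<Rightarrow> real ^ 'n) \<Rightarrow> real \<Rightarrow> ennreal" where
  "l_bound j f t =
     (SUP (z1, z2) \<in> {(z1, z2). z1 \<in> cball 0 (real j) \<and> z2 \<in> cball 0 (real j) \<and> z1 \<noteq> z2}.
        ennreal (norm (f t z1 - f t z2) / norm (z1 - z2)))"

definition l2_bound :: "nat \<Rightarrow> (real \<Rightarrow> (real ^ 'n) \<times> (real ^ 'n) \<Rightarrow> real ^ 'n) \<Rightarrow> real \<Rightarrow> ennreal" where
  "l2_bound j f t =
     (SUP (x, u1, u2) \<in> {(x, u1, u2). (x, u1) \<in> cball 0 (real j) \<and> (x, u2) \<in> cball 0 (real j) \<and> u1 \<noteq> u2}.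
        ennreal (norm (f t (x, u1) - f t (x, u2)) / norm (u1 - u2)))"

definition L1_loc_equicontinuous_m_bounds ::
    "(real \<Rightarrow> (real ^ 'n) \<times> (real ^ 'n) \<Rightarrow> real ^ 'n) set \<Rightarrow> bool" where
  "L1_loc_equicontinuous_m_bounds E \<longleftrightarrow>
     (\<forall>j. \<forall>r>0. \<forall>\<epsilon>>0. \<exists>\<delta>>0. \<forall>s t. - r \<le> s \<and> s \<le> t \<and> t \<le> r \<and> t - s < \<delta> \<longrightarrow>
        (SUP f\<in>E. \<integral>\<^sup>+ u\<in>{s..t}. m_bound j f u \<partial>lebesgue) < ennreal \<epsilon>)"

definition L1_loc_bounded_l_bounds ::
    "(real \<Rightarrow> (real ^ 'n) \<times> (real ^ 'n) \<Rightarrow> real ^ 'n) set \<Rightarrow> bool" where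
  "L1_loc_bounded_l_bounds E \<longleftrightarrow>
     (\<forall>j. \<forall>r>0. (SUP f\<in>E. \<integral>\<^sup>+ t\<in>{-r..r}. l_bound j f t \<partial>lebesgue) < \<infinity>)"

definition L1_loc_bounded_l2_bounds ::
    "(real \<Rightarrow> (real ^ 'n) \<times> (real ^ 'n) \<Rightarrow> real ^ 'n) set \<Rightarrow> bool" where
  "L1_loc_bounded_l2_bounds E \<longleftrightarrow>
     (\<forall>j. \<forall>r>0. (SUP f\<in>E. \<integral>\<^sup>+ t\<in>{-r..r}. l2_bound j f t \<partial>lebesgue) < \<infinity>)"

(* A set of moduli of continuity is given as \<Theta> j q1 q2 for the interval I = [q1, q2]. *)

(* The modulus given by the m-bounds of E; if E has equicontinuous m-bounds then the supremum
   is finite, so that the conversion to a real number loses nothing. *)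
definition m_moduli :: "(real \<Rightarrow> (real ^ 'n) \<times> (real ^ 'n) \<Rightarrow> real ^ 'n) set \<Rightarrow>
    nat \<Rightarrow> rat \<Rightarrow> rat \<Rightarrow> real \<Rightarrow> real" where
  "m_moduli E j q1 q2 s =
     enn2real (SUP t \<in> {of_rat q1..of_rat q2}. SUP f\<in>E.
       \<integral>\<^sup>+ u\<in>{t..t + s}. m_bound j f u \<partial>lebesgue)"

definition modulus_set :: "(nat \<Rightarrow> rat \<Rightarrow> rat \<Rightarrow> real \<Rightarrow> real) \<Rightarrow> nat \<Rightarrow> rat \<Rightarrow> rat \<Rightarrow>
    (real \<Rightarrow> real ^ 'n) set" where
  "modulus_set \<Theta> j q1 q2 =
     {x. continuous_on {of_rat q1..of_rat q2} x \<and>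
         x ` {of_rat q1..of_rat q2} \<subseteq> cball 0 (real j) \<and>
         (\<forall>t \<in> {of_rat q1..of_rat q2}. \<forall>s \<in> {of_rat q1..of_rat q2}.
            norm (x t - x s) \<le> \<Theta> j q1 q2 \<bar>t - s\<bar>)}"

definition seminorm_ThetaD ::
    "(nat \<Rightarrow> rat \<Rightarrow> rat \<Rightarrow> real \<Rightarrow> real) \<Rightarrow> nat \<Rightarrow> rat \<Rightarrow> rat \<Rightarrow> real ^ 'n \<Rightarrow>
     (real \<Rightarrow> (real ^ 'n) \<times> (real ^ 'n) \<Rightarrow> real ^ 'n) \<Rightarrow> ennreal" where
  "seminorm_ThetaD \<Theta> j q1 q2 u f =
     (SUP x \<in> modulus_set \<Theta> j q1 q2.
        \<integral>\<^sup>+ t\<in>{of_rat q1..of_rat q2}. ennreal (norm (f t (x t, u))) \<partial>lebesgue)"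

definition seminorm_D :: "rat \<Rightarrow> rat \<Rightarrow> (real ^ 'n) \<times> (real ^ 'n) \<Rightarrow>
     (real \<Rightarrow> (real ^ 'n) \<times> (real ^ 'n) \<Rightarrow> real ^ 'n) \<Rightarrow> ennreal" where
  "seminorm_D q1 q2 z f =
     (\<integral>\<^sup>+ t\<in>{of_rat q1..of_rat q2}. ennreal (norm (f t z)) \<partial>lebesgue)"

definition LC_topology ::
    "((real \<Rightarrow> (real ^ 'n) \<times> (real ^ 'n) \<Rightarrow> real ^ 'n) \<Rightarrow> ennreal) set \<Rightarrow>
     (real \<Rightarrow> (real ^ 'n) \<times> (real ^ 'n) \<Rightarrow> real ^ 'n) topology" where
  "LC_topology P = topology_generated_by
     {{g \<in> LC. p (\<lambda>t z. g t z - f t z) < ennreal \<epsilon>} | p f \<epsilon>. p \<in> P \<and> f \<in> LC \<and> \<epsilon> > 0}"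

definition T_ThetaD :: "(nat \<Rightarrow> rat \<Rightarrow> rat \<Rightarrow> real \<Rightarrow> real) \<Rightarrow> (real ^ 'n) set \<Rightarrow>
     (real \<Rightarrow> (real ^ 'n) \<times> (real ^ 'n) \<Rightarrow> real ^ 'n) topology" where
  "T_ThetaD \<Theta> D' = LC_topology {seminorm_ThetaD \<Theta> j q1 q2 u | j q1 q2 u. q1 \<le> q2 \<and> u \<in> D'}"

definition T_D :: "((real ^ 'n) \<times> (real ^ 'n)) set \<Rightarrow>
     (real \<Rightarrow> (real ^ 'n) \<times> (real ^ 'n) \<Rightarrow> real ^ 'n) topology" where
  "T_D D = LC_topology {seminorm_D q1 q2 z | q1 q2 z. q1 \<le> q2 \<and> z \<in> D}"

(* Only the values on I matter. *)
definition C11 :: "real set \<Rightarrow> (real \<Rightarrow> real ^ 'n) set" where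
  "C11 I = {x. continuous_on I x \<and>
     (AE t in lebesgue. t \<in> I \<longrightarrow> x differentiable (at t within I)) \<and>
     (\<lambda>t. vector_derivative x (at t within I)) absolutely_integrable_on I}"

definition C11_norm :: "real set \<Rightarrow> (real \<Rightarrow> real ^ 'n) \<Rightarrow> ennreal" where
  "C11_norm I x = (SUP t\<in>I. ennreal (norm (x t))) +
     (\<integral>\<^sup>+ t\<in>I. ennreal (norm (vector_derivative x (at t within I))) \<partial>lebesgue)"

(* Convergence in the normed space C11 I: the limit and eventually all terms belong to the space. *)
definition C11_tendsto :: "real set \<Rightarrow> (nat \<Rightarrow> real \<Rightarrow> real ^ 'n) \<Rightarrow> (real \<Rightarrow> real ^ 'n) \<Rightarrow> bool" where
  "C11_tendsto I xs x \<longleftrightarrow> x \<in> C11 I \<and> (\<forall>\<^sub>F n in sequentially. xs n \<in> C11 I) \<and>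
     (\<lambda>n. C11_norm I (\<lambda>t. xs n t - x t)) \<longlonglongrightarrow> 0"

(* x is a Caratheodory solution on [-1, b), where b may be infinite: the integral
   equation says that x is locally absolutely continuous on [0, b) and solves the equation a.e. *)
definition solution_on :: "(real \<Rightarrow> (real ^ 'n) \<times> (real ^ 'n) \<Rightarrow> real ^ 'n) \<Rightarrow> (real \<Rightarrow> real ^ 'n) \<Rightarrow>
    ereal \<Rightarrow> (real \<Rightarrow> real ^ 'n) \<Rightarrow> bool" where
  "solution_on f \<phi> b x \<longleftrightarrow> 0 < b \<and>
     continuous_on {t. -1 \<le> t \<and> ereal t < b} x \<and>
     (\<forall>t \<in> {-1..0}. x t = \<phi> t) \<and>
     (\<forall>t. 0 \<le> t \<and> ereal t < b \<longrightarrow>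
        (\<lambda>s. f s (x s, x (s - 1))) absolutely_integrable_on {0..t} \<and>
        x t = \<phi> 0 + integral {0..t} (\<lambda>s. f s (x s, x (s - 1))))"

definition maximal_solution :: "(real \<Rightarrow> (real ^ 'n) \<times> (real ^ 'n) \<Rightarrow> real ^ 'n) \<Rightarrow> (real \<Rightarrow> real ^ 'n) \<Rightarrow>
    ereal \<Rightarrow> (real \<Rightarrow> real ^ 'n) \<Rightarrow> bool" where
  "maximal_solution f \<phi> b x \<longleftrightarrow> solution_on f \<phi> b x \<and>
     (\<forall>b' y. solution_on f \<phi> b' y \<and> b \<le> b' \<and>
        (\<forall>t. -1 \<le> t \<and> ereal t < b \<longrightarrow> y t = x t) \<longrightarrow> b' = b)"

end

theory Submission
  imports Defs
begin

text \<open>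
  On \<open>[0, T]\<close> the difference \<open>d = |x\<^sub>n - x|\<close> satisfies a delayed Gronwall inequality
  \<open>d(t) \<le> d(s) + \<integral>\<^sub>s\<^sup>t k\<^sub>n(r) (d(r) + d(r - 1)) dr + \<epsilon>\<^sub>n\<close>, where the integrals of the kernels \<open>k\<^sub>n\<close> are bounded
  uniformly in \<open>n\<close> and \<open>\<epsilon>\<^sub>n\<close> tends to zero.

  In (ii) the kernel is an \<open>l\<close>-bound of \<open>f\<^sub>n\<close>, and \<open>\<epsilon>\<^sub>n\<close> is the integral of \<open>|f\<^sub>n - f|\<close> along
  \<open>(x(t), x(t - 1))\<close>. This curve is compact, so it may be replaced by a finite net in \<open>D\<close>, on which \<open>\<T>\<^sub>D\<close> controls
  \<open>f\<^sub>n - f\<close>. In (i) the kernel is the sum of an \<open>l\<^sub>2\<close>-bound of \<open>f\<^sub>n\<close> and an \<open>l\<close>-bound of \<open>f\<close>, and the points are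
  \<open>(x\<^sub>n(t), x(t - 1))\<close>: the \<open>m\<close>-bounds put \<open>x\<^sub>n\<close>, stopped before it leaves a ball, into \<open>\<K>\<^sub>j\<close>, and only the second
  component is replaced by a net in \<open>D'\<close>.

  Closeness first holds only while \<open>|x\<^sub>n - x| \<le> 1\<close>; as Gronwall gives a strictly better bound, \<open>x\<^sub>n\<close> cannot leave
  this tube, and a bounded maximal solution is global. The Gronwall bound also makes the derivatives converge in
  \<open>L\<^sup>1\<close>, since the derivative of a solution is a.e. the right-hand side.
\<close>

section \<open>Lebesgue differentiation of indefinite integrals\<close>

text \<open>Four obstacles shape the argument. The kernels change with n, so the time cuts in the
  Gronwall argument are made where the running integral of the kernel passes multiples of 1/4: the
  cut points move with n, but their number is controlled by the common integral bound, which makes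
  the constant independent of n. The net point nearest to a curve changes with time; summing the
  errors over the whole finite net avoids a measurable choice and costs only the cardinality of the
  net. In (i) no uniform Lipschitz bound in the first slot of \<open>fs n\<close> is available, so
  displacements in that slot are charged to the limit \<open>f\<close>, whose Lipschitz bound is one
  fixed function; this forces f_n - f to be tested along the moving curves x_n, which the suprema in
  the seminorms of \<open>T_ThetaD\<close> make possible. Finally, the derivative in the norm of
  \<open>C11\<close> is a pointwise one, so the integral equation has to be differentiated almost
  everywhere.\<close>

lemma indefinite_integral_diff_quotient_negligible:
  fixes g :: "real \<Rightarrow> 'a::euclidean_space"
  assumes g: "g integrable_on {a..b}" and "c > 0"
  defines "F \<equiv> \<lambda>t. integral {a..t} g"
  shows "negligible {x \<in> {a..b}. \<forall>d>0. \<exists>y\<in>{a..b}. y \<noteq> x \<and> \<bar>y - x\<bar> < d \<and>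
           c * \<bar>y - x\<bar> \<le> norm (F y - F x - (y - x) *\<^sub>R g x)}" (is "negligible ?B")
  unfolding negligible_outer_le
proof (intro allI impI)
  fix e :: real assume "e > 0"
  then have "c * e > 0" using \<open>c > 0\<close> by simp
  \<comment> \<open>Each bad interval will contribute at least \<open>c\<close> times its length to
    the Henstock sum, so the tolerance \<open>c * e\<close> limits the total length of disjoint bad
    intervals to \<open>e\<close>.\<close>
  obtain \<gamma> where \<gamma>: "gauge \<gamma>"
    and hen: "\<And>p. \<lbrakk>p tagged_partial_division_of (cbox a b); \<gamma> fine p\<rbrakk> \<Longrightarrow>
             sum (\<lambda>(x,k). norm (measure lborel k *\<^sub>R g x - integral k g)) p < c * e"
    using Henstock_lemma[of g a b "c * e"] g \<open>c * e > 0\<close> by (auto simp: cbox_interval)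
  \<comment> \<open>A bad interval is coded by its tag \<open>x\<close>, which is one endpoint, and
    the other endpoint \<open>y\<close>. Written as balls with centre \<open>m\<close> and radius
    \<open>r\<close>, arbitrarily small ones contain each bad point, so they form a Vitali cover of
    the bad set.\<close>
  define J where "J = {(x, y). x \<in> ?B \<and> y \<in> {a..b} \<and> y \<noteq> x \<and> {min x y..max x y} \<subseteq> \<gamma> x \<and>
           c * \<bar>y - x\<bar> \<le> norm (F y - F x - (y - x) *\<^sub>R g x)}"
  define m where "m = (\<lambda>(x, y). (x + y) / 2 :: real)"
  define r where "r = (\<lambda>(x, y). \<bar>y - x\<bar> / 2 :: real)"
  have cb: "cball (m (x, y)) (r (x, y)) = {min x y..max x y}" for x y
    unfolding m_def r_def cball_eq_atLeastAtMost by (cases "x \<le> y") (simp_all add: field_simps)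
  have fine: "\<exists>i. i \<in> J \<and> x \<in> cball (m i) (r i) \<and> r i < d" if x: "x \<in> ?B" and d: "d > 0" for x d
  proof -
    obtain \<delta> where \<delta>: "\<delta> > 0" "ball x \<delta> \<subseteq> \<gamma> x"
      using \<gamma> unfolding gauge_def by (meson openE)
    obtain y where y: "y \<in> {a..b}" "y \<noteq> x" "\<bar>y - x\<bar> < min d \<delta>"
        "c * \<bar>y - x\<bar> \<le> norm (F y - F x - (y - x) *\<^sub>R g x)"
    proof -
      have "0 < min d \<delta>" using d \<delta> by simp
      then show thesis using x that by blast
    qed
    have "{min x y..max x y} \<subseteq> ball x \<delta>"
      using y(3) by (auto simp: dist_real_def)
    then have "(x, y) \<in> J" unfolding J_def using x y \<delta> by blast
    moreover have "x \<in> cball (m (x, y)) (r (x, y))" unfolding cb by auto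
    moreover have "r (x, y) < d" using y(3) unfolding r_def by auto
    ultimately show ?thesis by blast
  qed
  have rpos: "0 < r i" if "i \<in> J" for i
    using that unfolding J_def r_def by auto
  obtain C where C: "countable C" "C \<subseteq> J"
     "pairwise (\<lambda>i j. disjnt (cball (m i) (r i)) (cball (m j) (r j))) C"
     "negligible (?B - (\<Union>i \<in> C. cball (m i) (r i)))"
    by (rule Vitali_covering_theorem_cballs[OF rpos fine])
  have bnd: "measure lebesgue (\<Union>i\<in>I. cball (m i) (r i)) \<le> e" if I: "I \<subseteq> C" "finite I" for I
  proof -
    \<comment> \<open>By disjointness, a finite subfamily tagged with its bad endpoints is a fine
      partial division, to which the Henstock estimate applies.\<close>
    define q where "q = (\<lambda>i. (fst i, cball (m i) (r i)))"
    have inj: "inj_on q I"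
    proof (rule inj_onI, rule ccontr)
      fix i j assume ij: "i \<in> I" "j \<in> I" "q i = q j" "i \<noteq> j"
      then have "disjnt (cball (m i) (r i)) (cball (m j) (r j))"
        using C(3) I unfolding pairwise_def by blast
      moreover have "m i \<in> cball (m i) (r i)" using ij I C unfolding J_def r_def by auto
      ultimately show False using ij unfolding q_def disjnt_def by auto
    qed
    have "(q ` I) tagged_partial_division_of (cbox a b)"
    unfolding tagged_partial_division_of_def
    proof (intro conjI allI impI; (elim conjE)?)
      show "finite (q ` I)" using I by simp
    next
      fix x K assume "(x, K) \<in> q ` I"
      then obtain y where y: "(x, y) \<in> I" "K = {min x y..max x y}"
        unfolding q_def using cb by auto
      then have "x \<in> {a..b}" "y \<in> {a..b}" using I C unfolding J_def by auto
      then show "K \<subseteq> cbox a b" "x \<in> K" "\<exists>a b. K = cbox a b"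
        using y by (auto simp: cbox_interval)
    next
      fix x1 K1 x2 K2 assume 1: "(x1, K1) \<in> q ` I" and 2: "(x2, K2) \<in> q ` I"
        and ne: "(x1, K1) \<noteq> (x2, K2)"
      then obtain i j where "i \<in> I" "j \<in> I" "i \<noteq> j" "K1 = cball (m i) (r i)" "K2 = cball (m j) (r j)"
        unfolding q_def by auto
      then have "disjnt K1 K2"
        using C(3) I unfolding pairwise_def by blast
      then show "interior K1 \<inter> interior K2 = {}"
        using interior_subset unfolding disjnt_def by blast
    qed
    moreover have "\<gamma> fine (q ` I)"
    proof (rule fineI)
      fix x K assume "(x, K) \<in> q ` I"
      then obtain y where y: "(x, y) \<in> I" "K = {min x y..max x y}"
        unfolding q_def using cb by auto
      then show "K \<subseteq> \<gamma> x" using I C unfolding J_def by auto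
    qed
    ultimately have "sum (\<lambda>(x,k). norm (measure lborel k *\<^sub>R g x - integral k g)) (q ` I) < c * e"
      by (rule hen)
    then have lt: "(\<Sum>i\<in>I. norm (measure lborel (cball (m i) (r i)) *\<^sub>R g (fst i) - integral (cball (m i) (r i)) g)) < c * e"
      by (simp add: sum.reindex[OF inj]) (simp add: q_def)
    have le_i: "c * measure lebesgue (cball (m i) (r i)) \<le>
        norm (measure lborel (cball (m i) (r i)) *\<^sub>R g (fst i) - integral (cball (m i) (r i)) g)" if "i \<in> I" for i
    proof -
      obtain x y where i: "i = (x, y)" by force
      then have J: "(x, y) \<in> J" using that I C by auto
      then have xy: "x \<in> {a..b}" "y \<in> {a..b}" "c * \<bar>y - x\<bar> \<le> norm (F y - F x - (y - x) *\<^sub>R g x)"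
        unfolding J_def by auto
      have FF: "F v - F u = integral {u..v} g" if "u \<le> v" "u \<in> {a..b}" "v \<in> {a..b}" for u v
      proof -
        have "g integrable_on {a..v}"
          by (rule integrable_subinterval_real[OF g]) (use that in auto)
        from Henstock_Kurzweil_Integration.integral_combine[of a u v g, OF _ _ this] that show ?thesis
          unfolding F_def by (auto simp: algebra_simps)
      qed
      show ?thesis
      proof (cases "x \<le> y")
        case True
        then show ?thesis using xy FF[of x y] unfolding i cb
          by (simp add: min_def max_def norm_minus_commute)
      next
        case False
        then have "F y - F x - (y - x) *\<^sub>R g x = (x - y) *\<^sub>R g x - integral {y..x} g"
          using xy FF[of y x] by (simp add: algebra_simps)
        with False show ?thesis using xy unfolding i cb
          by (simp add: min_def max_def)
      qed
    qed
    have "c * (\<Sum>i\<in>I. measure lebesgue (cball (m i) (r i))) < c * e"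
      unfolding sum_distrib_left using sum_mono[of I "\<lambda>i. c * measure lebesgue (cball (m i) (r i))", OF le_i] lt by linarith
    then have "(\<Sum>i\<in>I. measure lebesgue (cball (m i) (r i))) < e" using \<open>c > 0\<close> by simp
    moreover have "measure lebesgue (\<Union>i\<in>I. cball (m i) (r i)) \<le> (\<Sum>i\<in>I. measure lebesgue (cball (m i) (r i)))"
      by (rule measure_UNION_le) (use I in auto)
    ultimately show ?thesis by linarith
  qed
  let ?U = "\<Union>i\<in>C. cball (m i) (r i)"
  have U: "?U \<in> lmeasurable" "measure lebesgue ?U \<le> e"
    using fmeasurable_UN_bound[OF C(1), of "\<lambda>i. cball (m i) (r i)" lebesgue e]
          measure_UN_bound[OF C(1), of "\<lambda>i. cball (m i) (r i)" lebesgue e] bnd by auto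
  let ?N = "?B - ?U"
  have "?U \<union> ?N \<in> lmeasurable"
    using U C(4) by (intro fmeasurable.Un) (auto intro: negligible_imp_measurable)
  moreover have "measure lebesgue (?U \<union> ?N) \<le> measure lebesgue ?U + measure lebesgue ?N"
    using U C(4) by (intro measure_Un_le) (auto intro: negligible_imp_measurable fmeasurableD)
  moreover have "measure lebesgue ?N = 0" using C(4) by (rule negligible_imp_measure0)
  ultimately show "\<exists>T. ?B \<subseteq> T \<and> T \<in> lmeasurable \<and> measure lebesgue T \<le> e"
    using U by (intro exI[of _ "?U \<union> ?N"]) auto
qed

text \<open>Where the derivative fails, the error of the difference quotient stays above some
  \<open>inverse (real (Suc k))\<close> arbitrarily near the point, so the exceptional set is a
  countable union of the negligible sets treated above.\<close>

theorem has_vector_derivative_indefinite_integral_AE: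
  fixes g :: "real \<Rightarrow> 'a::euclidean_space"
  assumes g: "g integrable_on {a..b}"
  shows "AE x in lebesgue. x \<in> {a..b} \<longrightarrow>
    ((\<lambda>t. integral {a..t} g) has_vector_derivative g x) (at x within {a..b})"
proof -
  let ?F = "\<lambda>t. integral {a..t} g"
  define B where "B = (\<lambda>k::nat. {x \<in> {a..b}. \<forall>d>0. \<exists>y\<in>{a..b}. y \<noteq> x \<and> \<bar>y - x\<bar> < d \<and>
           inverse (real (Suc k)) * \<bar>y - x\<bar> \<le> norm (?F y - ?F x - (y - x) *\<^sub>R g x)})"
  have "negligible (B k)" for k
    unfolding B_def by (rule indefinite_integral_diff_quotient_negligible[OF g]) simp
  then have "(\<Union>k. B k) \<in> null_sets lebesgue"
    unfolding negligible_iff_null_sets[symmetric] by (intro negligible_countable_Union) auto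
  moreover have "(?F has_vector_derivative g x) (at x within {a..b})"
    if x: "x \<in> {a..b}" "x \<notin> (\<Union>k. B k)" for x
    unfolding has_vector_derivative_def has_derivative_within_alt
  proof (intro conjI allI impI)
    show "bounded_linear (\<lambda>h. h *\<^sub>R g x)" by (rule bounded_linear_scaleR_left)
    fix e :: real assume "e > 0"
    then obtain k where k: "inverse (real (Suc k)) < e" using reals_Archimedean by blast
    from x have "x \<notin> B k" by blast
    then obtain d where d: "d > 0" "\<And>y. y \<in> {a..b} \<Longrightarrow> y \<noteq> x \<Longrightarrow> \<bar>y - x\<bar> < d \<Longrightarrow>
        norm (?F y - ?F x - (y - x) *\<^sub>R g x) < inverse (real (Suc k)) * \<bar>y - x\<bar>"
      using x(1) unfolding B_def mem_Collect_eq not_all not_imp not_ex not_le bex_simps by (smt (verit))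
    have "norm (?F y - ?F x - (y - x) *\<^sub>R g x) \<le> e * norm (y - x)"
      if "y \<in> {a..b}" "norm (y - x) < d" for y
    proof (cases "y = x")
      case False
      then have "norm (?F y - ?F x - (y - x) *\<^sub>R g x) \<le> inverse (real (Suc k)) * \<bar>y - x\<bar>"
        using d(2)[of y] that by auto
      also have "\<dots> \<le> e * \<bar>y - x\<bar>" using k by (intro mult_right_mono) auto
      finally show ?thesis by simp
    qed simp
    with d(1) show "\<exists>d>0. \<forall>y\<in>{a..b}. norm (y - x) < d \<longrightarrow>
        norm (?F y - ?F x - (y - x) *\<^sub>R g x) \<le> e * norm (y - x)" by blast
  qed
  ultimately show ?thesis
    by (intro AE_I'[of "\<Union>k. B k"]) auto
qed

section \<open>Measurability and integrability of the optimal bounds\<close>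

text \<open>Rests on completeness of \<open>lebesgue\<close>. It is needed because the vector fields
  are continuous in space for almost every time only.\<close>

lemma borel_measurable_lebesgue_AE_cong:
  fixes f g :: "'a::euclidean_space \<Rightarrow> 'b::topological_space"
  assumes f: "f \<in> borel_measurable lebesgue" and ae: "AE x in lebesgue. f x = g x"
  shows "g \<in> borel_measurable lebesgue"
proof (rule measurableI)
  fix A :: "'b set" assume "A \<in> sets borel"
  then have fA: "f -` A \<inter> space lebesgue \<in> sets lebesgue" using f by (rule measurable_sets[rotated])
  have "AE x in lebesgue. x \<in> f -` A \<inter> space lebesgue \<longleftrightarrow> x \<in> g -` A \<inter> space lebesgue"
    using ae by eventually_elim auto
  then show "g -` A \<inter> space lebesgue \<in> sets lebesgue"
    using fA by (rule completion.in_sets_AE) auto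
qed simp

lemma SUP_eq_SUP_dense:
  fixes h :: "'a::metric_space \<Rightarrow> ennreal"
  assumes cont: "continuous_on S h" and T: "T \<subseteq> S" "S \<subseteq> closure T"
  shows "(SUP z\<in>S. h z) = (SUP z\<in>T. h z)"
proof (rule antisym)
  show "(SUP z\<in>S. h z) \<le> (SUP z\<in>T. h z)"
  proof (rule SUP_least)
    fix z assume z: "z \<in> S"
    then have "z \<in> closure T" using T by auto
    then obtain w where w: "\<And>n. w n \<in> T" "w \<longlonglongrightarrow> z"
      unfolding closure_sequential by blast
    then have "(\<lambda>n. h (w n)) \<longlonglongrightarrow> h z"
      using cont z T(1) unfolding continuous_on_sequentially o_def by (metis subsetD)
    then show "h z \<le> (SUP z\<in>T. h z)"
      by (rule LIMSEQ_le_const2) (auto intro: SUP_upper w)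
  qed
  show "(SUP z\<in>T. h z) \<le> (SUP z\<in>S. h z)"
    using T by (intro SUP_subset_mono) auto
qed

text \<open>An uncountable supremum of measurable functions may fail to be measurable; continuity in
  \<open>z\<close>, valid for almost every \<open>t\<close>, reduces it to a countable dense subset
  of \<open>S\<close>.\<close>

lemma borel_measurable_SUP_AE_continuous:
  fixes h :: "'b::euclidean_space \<Rightarrow> 'a::{metric_space, second_countable_topology} \<Rightarrow> ennreal"
  assumes h: "\<And>z. z \<in> S \<Longrightarrow> (\<lambda>t. h t z) \<in> borel_measurable lebesgue"
    and cont: "AE t in lebesgue. continuous_on S (h t)"
  shows "(\<lambda>t. SUP z\<in>S. h t z) \<in> borel_measurable lebesgue"
proof -
  obtain T where T: "countable T" "T \<subseteq> S" "S \<subseteq> closure T" by (rule separable)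
  have "(\<lambda>t. SUP z\<in>T. h t z) \<in> borel_measurable lebesgue"
    using T h by (intro borel_measurable_SUP) auto
  moreover have "AE t in lebesgue. (SUP z\<in>T. h t z) = (SUP z\<in>S. h t z)"
    using cont by eventually_elim (metis SUP_eq_SUP_dense T(2,3))
  ultimately show ?thesis by (rule borel_measurable_lebesgue_AE_cong)
qed

text \<open>Bridge between the extended nonnegative integrals of the bounds and seminorms and the
  gauge integral of the integral equation.\<close>

lemma nn_integral_norm_absolutely_integrable:
  fixes g :: "'a::euclidean_space \<Rightarrow> 'b::euclidean_space"
  assumes "g absolutely_integrable_on S"
  shows "(\<integral>\<^sup>+ t\<in>S. ennreal (norm (g t)) \<partial>lebesgue) = ennreal (integral S (\<lambda>t. norm (g t)))"
proof -
  have n: "set_integrable lebesgue S (\<lambda>t. norm (g t))"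
    using assms by (rule set_integrable_norm)
  have "(\<integral>\<^sup>+ t\<in>S. ennreal (norm (g t)) \<partial>lebesgue) = (\<integral>\<^sup>+ t. ennreal (indicator S t *\<^sub>R norm (g t)) \<partial>lebesgue)"
    by (intro nn_integral_cong) (auto split: split_indicator)
  also have "\<dots> = ennreal (LINT t:S|lebesgue. norm (g t))"
    using n unfolding set_integrable_def set_lebesgue_integral_def
    by (intro nn_integral_eq_integral) auto
  finally show ?thesis using set_lebesgue_integral_eq_integral(2)[OF n] by simp
qed

lemma norm_integral_le_nn_integral:
  fixes g :: "'a::euclidean_space \<Rightarrow> 'b::euclidean_space"
  assumes "g absolutely_integrable_on S"
  shows "ennreal (norm (integral S g)) \<le> (\<integral>\<^sup>+ t\<in>S. ennreal (norm (g t)) \<partial>lebesgue)"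
  unfolding nn_integral_norm_absolutely_integrable[OF assms]
  using assms by (intro ennreal_leI integral_norm_bound_integral) (auto simp: absolutely_integrable_on_def)

lemma absolutely_integrable_nn_integral_finite:
  fixes g :: "'a::euclidean_space \<Rightarrow> 'b::euclidean_space"
  assumes "g \<in> borel_measurable lebesgue" "S \<in> sets lebesgue"
    and "(\<integral>\<^sup>+ t\<in>S. ennreal (norm (g t)) \<partial>lebesgue) < \<infinity>"
  shows "g absolutely_integrable_on S"
  unfolding set_integrable_def
proof (rule integrableI_bounded)
  show "(\<lambda>x. indicat_real S x *\<^sub>R g x) \<in> borel_measurable lebesgue" using assms by measurable
  have "(\<integral>\<^sup>+ x. ennreal (norm (indicat_real S x *\<^sub>R g x)) \<partial>lebesgue) = (\<integral>\<^sup>+ t\<in>S. ennreal (norm (g t)) \<partial>lebesgue)"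
    by (intro nn_integral_cong) (auto split: split_indicator)
  with assms(3) show "(\<integral>\<^sup>+ x. ennreal (norm (indicat_real S x *\<^sub>R g x)) \<partial>lebesgue) < \<infinity>" by simp
qed

lemma integral_norm_mono_AE:
  fixes g :: "'a::euclidean_space \<Rightarrow> 'b::euclidean_space"
  assumes g: "g absolutely_integrable_on S" and h: "h absolutely_integrable_on S"
    and le: "AE t in lebesgue. t \<in> S \<longrightarrow> norm (g t) \<le> h t"
  shows "integral S (\<lambda>t. norm (g t)) \<le> integral S h"
proof -
  have n: "set_integrable lebesgue S (\<lambda>t. norm (g t))"
    using g by (rule set_integrable_norm)
  show ?thesis
    using set_integral_mono_AE[OF n h le] set_lebesgue_integral_eq_integral(2)[OF n]
      set_lebesgue_integral_eq_integral(2)[OF h] by simp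
qed

lemma norm_integral_le_integral_AE:
  fixes g :: "'a::euclidean_space \<Rightarrow> 'b::euclidean_space"
  assumes g: "g absolutely_integrable_on S" and h: "h absolutely_integrable_on S"
    and le: "AE t in lebesgue. t \<in> S \<longrightarrow> norm (g t) \<le> h t"
  shows "norm (integral S g) \<le> integral S h"
proof -
  have "norm (integral S g) \<le> integral S (\<lambda>t. norm (g t))"
    using g by (intro integral_norm_bound_integral) (auto simp: absolutely_integrable_on_def)
  with integral_norm_mono_AE[OF assms] show ?thesis by linarith
qed

lemma absolutely_integrable_AE_bound:
  fixes g :: "'a::euclidean_space \<Rightarrow> 'b::euclidean_space"
  assumes g: "g \<in> borel_measurable lebesgue" and S: "S \<in> sets lebesgue"
    and h: "h absolutely_integrable_on S"
    and le: "AE t in lebesgue. t \<in> S \<longrightarrow> norm (g t) \<le> h t"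
  shows "g absolutely_integrable_on S"
proof (rule absolutely_integrable_nn_integral_finite[OF g S])
  have "(\<integral>\<^sup>+ t\<in>S. ennreal (norm (g t)) \<partial>lebesgue) \<le> (\<integral>\<^sup>+ t\<in>S. ennreal (norm (h t)) \<partial>lebesgue)"
    using le by (intro nn_integral_mono_AE) (auto split: split_indicator intro!: ennreal_leI elim!: eventually_mono)
  then show "(\<integral>\<^sup>+ t\<in>S. ennreal (norm (g t)) \<partial>lebesgue) < \<infinity>"
    unfolding nn_integral_norm_absolutely_integrable[OF h] by (simp add: le_less_trans)
qed

section \<open>Fields in \<open>LC\<close> and their optimal bounds\<close>

lemma LC_borel: "f \<in> LC \<Longrightarrow> (\<lambda>(t, z). f t z) \<in> borel_measurable borel"
  unfolding LC_def by blast

lemma LC_compose_borel: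
  assumes "f \<in> LC" "v \<in> borel_measurable borel"
  shows "(\<lambda>t. f t (v t)) \<in> borel_measurable borel"
proof -
  have "(\<lambda>t. (t, v t)) \<in> borel_measurable borel"
    using assms(2) by (intro borel_measurable_Pair) auto
  from measurable_compose[OF this LC_borel[OF assms(1)]] show ?thesis by simp
qed

lemma LC_compose_lebesgue:
  assumes "f \<in> LC" "v \<in> borel_measurable borel"
  shows "(\<lambda>t. f t (v t)) \<in> borel_measurable lebesgue"
proof -
  have "(\<lambda>t. f t (v t)) \<in> borel_measurable lborel"
    using LC_compose_borel[OF assms] by simp
  then show ?thesis by (rule measurable_completion)
qed

text \<open>Replacing the bounds by their absolute values makes them nonnegative at every time, so
  that later integrals are monotone in the domain without exceptional sets.\<close>

lemma LC_bounds:
  assumes "f \<in> LC" "compact K"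
  obtains m l where "\<And>a b. m absolutely_integrable_on {a..b}" "\<And>a b. l absolutely_integrable_on {a..b}"
    "\<And>t. 0 \<le> m t" "\<And>t. 0 \<le> l t"
    "AE t in lebesgue. (\<forall>z\<in>K. norm (f t z) \<le> m t) \<and>
        (\<forall>z1\<in>K. \<forall>z2\<in>K. norm (f t z1 - f t z2) \<le> l t * norm (z1 - z2))"
proof -
  obtain m l where ml: "m \<in> L1_loc" "l \<in> L1_loc" "AE t in lebesgue. (\<forall>z\<in>K. norm (f t z) \<le> m t) \<and>
        (\<forall>z1\<in>K. \<forall>z2\<in>K. norm (f t z1 - f t z2) \<le> l t * norm (z1 - z2))"
    using assms unfolding LC_def by blast
  show thesis
  proof (rule that[of "\<lambda>t. \<bar>m t\<bar>" "\<lambda>t. \<bar>l t\<bar>"])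
    show "(\<lambda>t. \<bar>m t\<bar>) absolutely_integrable_on {a..b}" "(\<lambda>t. \<bar>l t\<bar>) absolutely_integrable_on {a..b}" for a b
      using ml unfolding L1_loc_def by (auto intro!: set_integrable_abs)
    show "AE t in lebesgue. (\<forall>z\<in>K. norm (f t z) \<le> \<bar>m t\<bar>) \<and>
        (\<forall>z1\<in>K. \<forall>z2\<in>K. norm (f t z1 - f t z2) \<le> \<bar>l t\<bar> * norm (z1 - z2))"
      using ml(3)
    proof eventually_elim
      case (elim t)
      have "l t * norm (z1 - z2) \<le> \<bar>l t\<bar> * norm (z1 - z2)" for z1 z2
        by (intro mult_right_mono) auto
      with elim show ?case by (meson abs_ge_self order_trans)
    qed
  qed auto
qed

lemma LC_AE_continuous:
  assumes "f \<in> LC" "compact K"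
  shows "AE t in lebesgue. continuous_on K (f t)"
proof -
  obtain m l where "\<And>a b. m absolutely_integrable_on {a..b}" "\<And>a b. l absolutely_integrable_on {a..b}"
    "\<And>t. 0 \<le> m t" and l: "\<And>t. 0 \<le> l t" and ae: "AE t in lebesgue. (\<forall>z\<in>K. norm (f t z) \<le> m t) \<and>
        (\<forall>z1\<in>K. \<forall>z2\<in>K. norm (f t z1 - f t z2) \<le> l t * norm (z1 - z2))"
    by (rule LC_bounds[OF assms]) (rule that)
  from ae show ?thesis
  proof eventually_elim
    case (elim t)
    then have "(l t)-lipschitz_on K (f t)"
      using l by (auto simp: lipschitz_on_def dist_norm)
    then show ?case by (rule lipschitz_on_continuous_on)
  qed
qed

lemma m_bound_measurable:
  assumes "f \<in> LC"
  shows "m_bound j f \<in> borel_measurable lebesgue"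
  unfolding m_bound_def
proof (rule borel_measurable_SUP_AE_continuous)
  show "(\<lambda>t. ennreal (norm (f t z))) \<in> borel_measurable lebesgue" for z
    using LC_compose_lebesgue[OF assms, of "\<lambda>_. z"] by measurable
  show "AE t in lebesgue. continuous_on (cball 0 (real j)) (\<lambda>z. ennreal (norm (f t z)))"
    using LC_AE_continuous[OF assms compact_cball[of 0 "real j"]]
    by eventually_elim (intro continuous_on_ennreal continuous_on_norm)
qed

text \<open>On the set of pairs off the diagonal the difference quotient is continuous. This set is
  not closed in general, but separability is all that the reduction to a countable supremum asks of
  it.\<close>

lemma l_bound_measurable:
  assumes "f \<in> LC"
  shows "l_bound j f \<in> borel_measurable lebesgue"
proof -
  let ?S = "{(z1, z2). z1 \<in> cball 0 (real j) \<and> z2 \<in> cball 0 (real j) \<and> z1 \<noteq> z2}"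
  have "(\<lambda>t. SUP p\<in>?S. ennreal (norm (f t (fst p) - f t (snd p)) / norm (fst p - snd p))) \<in> borel_measurable lebesgue"
  proof (rule borel_measurable_SUP_AE_continuous)
    show "(\<lambda>t. ennreal (norm (f t (fst p) - f t (snd p)) / norm (fst p - snd p))) \<in> borel_measurable lebesgue" for p
      using LC_compose_lebesgue[OF assms, of "\<lambda>_. fst p"] LC_compose_lebesgue[OF assms, of "\<lambda>_. snd p"]
      by measurable
    show "AE t in lebesgue. continuous_on ?S (\<lambda>p. ennreal (norm (f t (fst p) - f t (snd p)) / norm (fst p - snd p)))"
      using LC_AE_continuous[OF assms compact_cball[of 0 "real j"]]
    proof eventually_elim
      case (elim t)
      have "continuous_on ?S (\<lambda>p. f t (fst p))" "continuous_on ?S (\<lambda>p. f t (snd p))"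
        by (rule continuous_on_compose2[OF elim]; auto intro!: continuous_intros)+
      then show ?case by (intro continuous_on_ennreal continuous_on_divide continuous_on_norm continuous_on_diff) (auto intro!: continuous_intros)
    qed
  qed
  then show ?thesis unfolding l_bound_def case_prod_beta .
qed

lemma l2_bound_measurable:
  assumes "f \<in> LC"
  shows "l2_bound j f \<in> borel_measurable lebesgue"
proof -
  let ?S = "{(x, u1, u2). (x, u1) \<in> cball 0 (real j) \<and> (x, u2) \<in> cball 0 (real j) \<and> u1 \<noteq> u2}"
  let ?g = "\<lambda>t p. norm (f t (fst p, fst (snd p)) - f t (fst p, snd (snd p))) / norm (fst (snd p) - snd (snd p))"
  have "(\<lambda>t. SUP p\<in>?S. ennreal (?g t p)) \<in> borel_measurable lebesgue"
  proof (rule borel_measurable_SUP_AE_continuous)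
    show "(\<lambda>t. ennreal (?g t p)) \<in> borel_measurable lebesgue" for p
      using LC_compose_lebesgue[OF assms, of "\<lambda>_. (fst p, fst (snd p))"]
        LC_compose_lebesgue[OF assms, of "\<lambda>_. (fst p, snd (snd p))"]
      by measurable
    show "AE t in lebesgue. continuous_on ?S (\<lambda>p. ennreal (?g t p))"
      using LC_AE_continuous[OF assms compact_cball[of 0 "real j"]]
    proof eventually_elim
      case (elim t)
      have "continuous_on ?S (\<lambda>p. f t (fst p, fst (snd p)))" "continuous_on ?S (\<lambda>p. f t (fst p, snd (snd p)))"
        by (rule continuous_on_compose2[OF elim]; auto intro!: continuous_intros)+
      then show ?case by (intro continuous_on_ennreal continuous_on_divide continuous_on_norm continuous_on_diff) (auto intro!: continuous_intros)
    qed
  qed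
  then show ?thesis unfolding l2_bound_def case_prod_beta .
qed

text \<open>\<open>enn2real\<close> sends infinity to 0, which would destroy an upper bound; a
  finite integral confines the value infinity to a null set.\<close>

lemma enn2real_kernel:
  fixes B :: "real \<Rightarrow> ennreal"
  assumes B: "B \<in> borel_measurable lebesgue" and S: "S \<in> sets lebesgue"
    and le: "(\<integral>\<^sup>+ t\<in>S. B t \<partial>lebesgue) \<le> ennreal C" and "0 \<le> C"
  shows "(\<lambda>t. enn2real (B t)) absolutely_integrable_on S"
    and "integral S (\<lambda>t. enn2real (B t)) \<le> C"
    and "AE t in lebesgue. t \<in> S \<longrightarrow> B t = ennreal (enn2real (B t))"
proof -
  have BS: "(\<lambda>t. B t * indicator S t) \<in> borel_measurable lebesgue" using B S by measurable
  have "(\<integral>\<^sup>+ t\<in>S. B t \<partial>lebesgue) \<noteq> \<infinity>" using le by (auto simp: top_unique)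
  then have "AE t in lebesgue. B t * indicator S t \<noteq> \<infinity>"
    by (rule nn_integral_PInf_AE[OF BS])
  then show ae: "AE t in lebesgue. t \<in> S \<longrightarrow> B t = ennreal (enn2real (B t))"
    by eventually_elim (auto split: split_indicator_asm simp: less_top)
  have eq: "(\<integral>\<^sup>+ t\<in>S. ennreal (norm (enn2real (B t))) \<partial>lebesgue) = (\<integral>\<^sup>+ t\<in>S. B t \<partial>lebesgue)"
    using ae by (intro nn_integral_cong_AE) (auto split: split_indicator elim!: eventually_mono)
  show ai: "(\<lambda>t. enn2real (B t)) absolutely_integrable_on S"
  proof (rule absolutely_integrable_nn_integral_finite[OF _ S])
    show "(\<lambda>t. enn2real (B t)) \<in> borel_measurable lebesgue" using B by measurable
    show "(\<integral>\<^sup>+ t\<in>S. ennreal (norm (enn2real (B t))) \<partial>lebesgue) < \<infinity>"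
      unfolding eq using le by (simp add: le_less_trans)
  qed
  have "ennreal (integral S (\<lambda>t. norm (enn2real (B t)))) \<le> ennreal C"
    using nn_integral_norm_absolutely_integrable[OF ai] eq le by simp
  then show "integral S (\<lambda>t. enn2real (B t)) \<le> C" using \<open>0 \<le> C\<close> by simp
qed

lemma l_bound_kernel:
  fixes f :: "real \<Rightarrow> (real ^ 'n) \<times> (real ^ 'n) \<Rightarrow> real ^ 'n"
  assumes f: "f \<in> LC" and S: "S \<in> sets lebesgue"
    and le: "(\<integral>\<^sup>+ t\<in>S. l_bound j f t \<partial>lebesgue) \<le> ennreal C" and C: "0 \<le> C"
  obtains k where "k absolutely_integrable_on S" "\<And>t. 0 \<le> k t" "integral S k \<le> C"
    "AE t in lebesgue. t \<in> S \<longrightarrow> (\<forall>z1\<in>cball 0 (real j). \<forall>z2\<in>cball 0 (real j).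
        norm (f t z1 - f t z2) \<le> k t * norm (z1 - z2))"
proof (rule that)
  note K = enn2real_kernel[OF l_bound_measurable[OF f] S le C]
  show "(\<lambda>t. enn2real (l_bound j f t)) absolutely_integrable_on S" "integral S (\<lambda>t. enn2real (l_bound j f t)) \<le> C"
    using K by auto
  show "AE t in lebesgue. t \<in> S \<longrightarrow> (\<forall>z1\<in>cball 0 (real j). \<forall>z2\<in>cball 0 (real j).
        norm (f t z1 - f t z2) \<le> enn2real (l_bound j f t) * norm (z1 - z2))"
    using K(3)
  proof (eventually_elim, intro impI ballI)
    fix t :: real and z1 z2 :: "(real ^ 'n) \<times> (real ^ 'n)" assume t: "t \<in> S \<longrightarrow> l_bound j f t = ennreal (enn2real (l_bound j f t))" "t \<in> S"
      and z: "z1 \<in> cball 0 (real j)" "z2 \<in> cball 0 (real j)"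
    show "norm (f t z1 - f t z2) \<le> enn2real (l_bound j f t) * norm (z1 - z2)"
    proof (cases "z1 = z2")
      case False
      have "ennreal (norm (f t z1 - f t z2) / norm (z1 - z2)) \<le> l_bound j f t"
        unfolding l_bound_def using z False by (intro SUP_upper2[of "(z1, z2)"]) auto
      then have "norm (f t z1 - f t z2) / norm (z1 - z2) \<le> enn2real (l_bound j f t)"
        using t by (metis enn2real_nonneg ennreal_le_iff)
      then show ?thesis using False by (simp add: field_simps)
    qed simp
  qed
qed simp

lemma l2_bound_kernel:
  fixes f :: "real \<Rightarrow> (real ^ 'n) \<times> (real ^ 'n) \<Rightarrow> real ^ 'n"
  assumes f: "f \<in> LC" and S: "S \<in> sets lebesgue"
    and le: "(\<integral>\<^sup>+ t\<in>S. l2_bound j f t \<partial>lebesgue) \<le> ennreal C" and C: "0 \<le> C"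
  obtains k where "k absolutely_integrable_on S" "\<And>t. 0 \<le> k t" "integral S k \<le> C"
    "AE t in lebesgue. t \<in> S \<longrightarrow> (\<forall>x u1 u2. (x, u1) \<in> cball 0 (real j) \<longrightarrow> (x, u2) \<in> cball 0 (real j) \<longrightarrow>
        norm (f t (x, u1) - f t (x, u2)) \<le> k t * norm (u1 - u2))"
proof (rule that)
  note K = enn2real_kernel[OF l2_bound_measurable[OF f] S le C]
  show "(\<lambda>t. enn2real (l2_bound j f t)) absolutely_integrable_on S" "integral S (\<lambda>t. enn2real (l2_bound j f t)) \<le> C"
    using K by auto
  show "AE t in lebesgue. t \<in> S \<longrightarrow> (\<forall>x u1 u2. (x, u1) \<in> cball 0 (real j) \<longrightarrow> (x, u2) \<in> cball 0 (real j) \<longrightarrow>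
        norm (f t (x, u1) - f t (x, u2)) \<le> enn2real (l2_bound j f t) * norm (u1 - u2))"
    using K(3)
  proof (eventually_elim, intro impI allI)
    fix t :: real and x u1 u2 :: "real ^ 'n" assume t: "t \<in> S \<longrightarrow> l2_bound j f t = ennreal (enn2real (l2_bound j f t))" "t \<in> S"
      and z: "(x, u1) \<in> cball 0 (real j)" "(x, u2) \<in> cball 0 (real j)"
    show "norm (f t (x, u1) - f t (x, u2)) \<le> enn2real (l2_bound j f t) * norm (u1 - u2)"
    proof (cases "u1 = u2")
      case False
      have "ennreal (norm (f t (x, u1) - f t (x, u2)) / norm (u1 - u2)) \<le> l2_bound j f t"
        unfolding l2_bound_def using z False by (intro SUP_upper2[of "(x, u1, u2)"]) auto
      then have "norm (f t (x, u1) - f t (x, u2)) / norm (u1 - u2) \<le> enn2real (l2_bound j f t)"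
        using t by (metis enn2real_nonneg ennreal_le_iff)
      then show ?thesis using False by (simp add: field_simps)
    qed simp
  qed
qed simp

section \<open>Existence and comparison of solutions\<close>

text \<open>Picard map as a contraction: \<open>h\<close> is so close to \<open>c\<close> that the
  integral of \<open>m\<close> is at most 1, which keeps the images in the unit ball about
  \<open>p\<close>, and that of \<open>l\<close> at most 1/2, which is the contraction constant in
  the sup norm. \<open>F\<close> is merely jointly Borel with bounds holding almost everywhere, so
  an already known delayed term can be absorbed into it.\<close>

lemma caratheodory_local_existence:
  fixes F :: "real \<Rightarrow> 'a::euclidean_space \<Rightarrow> 'a" and c d :: real
  assumes F: "(\<lambda>(t, z). F t z) \<in> borel_measurable borel" and "c < d"
    and m: "m absolutely_integrable_on {c..d}" and l: "l absolutely_integrable_on {c..d}"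
    and ml: "\<And>t. 0 \<le> m t" "\<And>t. 0 \<le> l t"
    and ae: "AE t in lebesgue. t \<in> {c..d} \<longrightarrow> (\<forall>z\<in>cball p 1. norm (F t z) \<le> m t) \<and>
        (\<forall>z1\<in>cball p 1. \<forall>z2\<in>cball p 1. norm (F t z1 - F t z2) \<le> l t * norm (z1 - z2))"
  obtains h y where "c < h" "h \<le> d" "continuous_on {c..h} y"
    "\<And>t. t \<in> {c..h} \<Longrightarrow> (\<lambda>s. F s (y s)) absolutely_integrable_on {c..t}"
    "\<And>t. t \<in> {c..h} \<Longrightarrow> y t = p + integral {c..t} (\<lambda>s. F s (y s))"
proof -
  have small: "\<exists>\<delta>>0. \<forall>t\<in>{c..d}. t - c < \<delta> \<longrightarrow> integral {c..t} k < e"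
    if "k absolutely_integrable_on {c..d}" "0 < e" for k :: "real \<Rightarrow> real" and e
  proof -
    have "continuous_on {c..d} (\<lambda>t. integral {c..t} k)"
      using that by (intro indefinite_integral_continuous_1) (auto simp: absolutely_integrable_on_def)
    moreover have "c \<in> {c..d}" using \<open>c < d\<close> by simp
    ultimately obtain \<delta> where "\<delta> > 0" "\<forall>t\<in>{c..d}. dist t c < \<delta> \<longrightarrow> dist (integral {c..t} k) (integral {c..c} k) < e"
      using \<open>0 < e\<close> unfolding continuous_on_iff by blast
    then show ?thesis by (intro exI[of _ \<delta>]) (auto simp: dist_real_def)
  qed
  obtain \<delta>1 where \<delta>1: "\<delta>1 > 0" "\<forall>t\<in>{c..d}. t - c < \<delta>1 \<longrightarrow> integral {c..t} m < 1"
    using small[OF m, of 1] by auto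
  obtain \<delta>2 where \<delta>2: "\<delta>2 > 0" "\<forall>t\<in>{c..d}. t - c < \<delta>2 \<longrightarrow> integral {c..t} l < 1 / 2"
    using small[OF l, of "1 / 2"] by auto
  \<comment> \<open>Half of the smaller \<delta> makes \<open>h - c\<close> strictly less than
    both.\<close>
  define h where "h = min d (c + min \<delta>1 \<delta>2 / 2)"
  have h: "c < h" "h \<le> d" using \<delta>1 \<delta>2 \<open>c < d\<close> unfolding h_def by auto
  have "h \<in> {c..d}" "h - c < \<delta>1" "h - c < \<delta>2" using h \<delta>1 \<delta>2 unfolding h_def by auto
  then have im: "integral {c..h} m \<le> 1" and il: "integral {c..h} l \<le> 1 / 2"
    using \<delta>1 \<delta>2 by force+
  have mh: "m absolutely_integrable_on {c..t}" and lh: "l absolutely_integrable_on {c..t}" if "t \<le> h" for t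
    using m l h that by (auto intro: absolutely_integrable_on_subinterval)
  \<comment> \<open>The iterates are bounded continuous functions on the whole line, a complete
    space. Clamping time to \<open>[c, h]\<close> by \<open>cl\<close> below turns the Picard
    integral, meaningful on that interval only, into such a function.\<close>
  define S where "S = PiC UNIV (\<lambda>_::real. cball p 1)"
  have SD: "apply_bcontfun u t \<in> cball p 1" if "u \<in> S" for u t
    using that unfolding S_def mem_PiC_iff by auto
  have G: "(\<lambda>s. F s (apply_bcontfun u s)) absolutely_integrable_on {c..t}" if "u \<in> S" "t \<le> h" for u t
  proof (rule absolutely_integrable_AE_bound)
    have "(\<lambda>s. (s, apply_bcontfun u s)) \<in> borel_measurable borel"
      by (intro borel_measurable_Pair borel_measurable_continuous_onI) auto
    from measurable_compose[OF this F]
    have "(\<lambda>s. F s (apply_bcontfun u s)) \<in> borel_measurable lborel" by simp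
    then show "(\<lambda>s. F s (apply_bcontfun u s)) \<in> borel_measurable lebesgue" by (rule measurable_completion)
    show "m absolutely_integrable_on {c..t}" using mh that by blast
    show "AE s in lebesgue. s \<in> {c..t} \<longrightarrow> norm (F s (apply_bcontfun u s)) \<le> m s"
      using ae that h SD by (auto elim!: eventually_mono)
  qed simp
  define cl where "cl = (\<lambda>t. min h (max c t))"
  have cl: "cl t \<in> {c..h}" for t using h unfolding cl_def by auto
  define P where "P = (\<lambda>u t. p + integral {c..cl t} (\<lambda>s. F s (apply_bcontfun u s)))"
  have Pball: "P u t \<in> cball p 1" if u: "u \<in> S" for u t
  proof -
    have "norm (integral {c..cl t} (\<lambda>s. F s (apply_bcontfun u s))) \<le> integral {c..cl t} m"
    proof (rule norm_integral_le_integral_AE[OF G[OF u] mh])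
      show "AE s in lebesgue. s \<in> {c..cl t} \<longrightarrow> norm (F s (apply_bcontfun u s)) \<le> m s"
        using ae u h SD cl[of t] by (auto elim!: eventually_mono)
    qed (use cl[of t] in auto)
    also have "\<dots> \<le> integral {c..h} m"
      using cl[of t] mh[of h] mh[of "cl t"] ml
      by (intro integral_subset_le) (auto simp: absolutely_integrable_on_def)
    finally show ?thesis using im unfolding P_def by (simp add: dist_norm)
  qed
  have Pb: "P u \<in> bcontfun" if u: "u \<in> S" for u
  proof -
    have "continuous_on {c..h} (\<lambda>t. integral {c..t} (\<lambda>s. F s (apply_bcontfun u s)))"
      using G[OF u, of h] by (intro indefinite_integral_continuous_1) (auto simp: absolutely_integrable_on_def)
    moreover have "continuous_on UNIV cl" unfolding cl_def by (intro continuous_intros)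
    ultimately have "continuous_on UNIV (\<lambda>t. integral {c..cl t} (\<lambda>s. F s (apply_bcontfun u s)))"
      by (rule continuous_on_compose2) (use cl in auto)
    then have "continuous_on UNIV (P u)" unfolding P_def by (intro continuous_intros)
    moreover have "bounded (range (P u))"
      using Pball[OF u] by (intro bounded_subset[OF bounded_cball[of p 1]]) auto
    ultimately show ?thesis unfolding bcontfun_def by simp
  qed
  have ap: "apply_bcontfun (Bcontfun (P u)) = P u" if "u \<in> S" for u
    using Pb[OF that] by (rule Bcontfun_inverse)
  have "\<exists>!u\<in>S. Bcontfun (P u) = u"
  proof (rule Banach_fix[where c = "1 / 2"])
    show "complete S" unfolding S_def complete_eq_closed by (rule closed_PiC) simp
    have "const_bcontfun p \<in> S" unfolding S_def by (auto simp: mem_PiC_iff const_bcontfun.rep_eq)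
    then show "S \<noteq> {}" by blast
    show "(\<lambda>u. Bcontfun (P u)) ` S \<subseteq> S"
      using Pball by (auto simp: S_def mem_PiC_iff ap[unfolded S_def])
    fix u v assume uv: "u \<in> S" "v \<in> S"
    show "dist (Bcontfun (P u)) (Bcontfun (P v)) \<le> 1 / 2 * dist u v"
    proof (rule dist_bound)
      fix t
      let ?D = "\<lambda>s. F s (apply_bcontfun u s) - F s (apply_bcontfun v s)"
      have D: "?D absolutely_integrable_on {c..cl t}"
        using G[OF uv(1), of "cl t"] G[OF uv(2), of "cl t"] cl[of t] by (intro set_integral_diff(1)) auto
      have Ld: "(\<lambda>s. l s * dist u v) absolutely_integrable_on {c..cl t}"
        using lh[of "cl t"] cl[of t] by (intro set_integrable_mult_left) auto
      have "dist (P u t) (P v t) = norm (integral {c..cl t} ?D)"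
        using G[OF uv(1), of "cl t"] G[OF uv(2), of "cl t"] cl[of t] unfolding P_def dist_norm
        by (subst Henstock_Kurzweil_Integration.integral_diff) (auto simp: absolutely_integrable_on_def)
      also have "\<dots> \<le> integral {c..cl t} (\<lambda>s. l s * dist u v)"
      proof (rule norm_integral_le_integral_AE[OF D Ld])
        show "AE s in lebesgue. s \<in> {c..cl t} \<longrightarrow> norm (?D s) \<le> l s * dist u v"
          using ae
        proof (eventually_elim, intro impI)
          fix s assume s: "s \<in> {c..cl t}" and "s \<in> {c..d} \<longrightarrow> (\<forall>z\<in>cball p 1. norm (F s z) \<le> m s) \<and>
            (\<forall>z1\<in>cball p 1. \<forall>z2\<in>cball p 1. norm (F s z1 - F s z2) \<le> l s * norm (z1 - z2))"
          then have "norm (?D s) \<le> l s * norm (apply_bcontfun u s - apply_bcontfun v s)"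
            using cl[of t] h SD uv by auto
          also have "\<dots> \<le> l s * dist u v"
            using ml dist_bounded[of u s v] by (intro mult_left_mono) (auto simp: dist_norm)
          finally show "norm (?D s) \<le> l s * dist u v" .
        qed
      qed
      also have "\<dots> = integral {c..cl t} l * dist u v" by simp
      also have "\<dots> \<le> 1 / 2 * dist u v"
      proof (rule mult_right_mono)
        have "integral {c..cl t} l \<le> integral {c..h} l"
          using cl[of t] lh[of h] lh[of "cl t"] ml
          by (intro integral_subset_le) (auto simp: absolutely_integrable_on_def)
        then show "integral {c..cl t} l \<le> 1 / 2" using il by linarith
      qed simp
      finally show "dist (apply_bcontfun (Bcontfun (P u)) t) (apply_bcontfun (Bcontfun (P v)) t) \<le> 1 / 2 * dist u v"
        using ap uv by simp
    qed
  qed auto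
  then obtain u where u: "u \<in> S" "Bcontfun (P u) = u" by blast
  show thesis
  proof (rule that[OF h])
    show "continuous_on {c..h} (apply_bcontfun u)" by simp
    show "(\<lambda>s. F s (apply_bcontfun u s)) absolutely_integrable_on {c..t}" if "t \<in> {c..h}" for t
      using G[OF u(1)] that by auto
    show "apply_bcontfun u t = p + integral {c..t} (\<lambda>s. F s (apply_bcontfun u s))" if "t \<in> {c..h}" for t
    proof -
      have "apply_bcontfun u t = P u t" using ap[OF u(1)] u(2) by metis
      also have "cl t = t" using that unfolding cl_def by auto
      then have "P u t = p + integral {c..t} (\<lambda>s. F s (apply_bcontfun u s))" unfolding P_def by simp
      finally show ?thesis .
    qed
  qed
qed

section \<open>The integral equation and continuation of solutions\<close>

lemma solution_onD:
  assumes "solution_on f \<phi> b x"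
  shows "0 < b" "continuous_on {t. -1 \<le> t \<and> ereal t < b} x" "\<And>t. t \<in> {-1..0} \<Longrightarrow> x t = \<phi> t"
    "\<And>t. 0 \<le> t \<Longrightarrow> ereal t < b \<Longrightarrow> (\<lambda>s. f s (x s, x (s - 1))) absolutely_integrable_on {0..t}"
    "\<And>t. 0 \<le> t \<Longrightarrow> ereal t < b \<Longrightarrow> x t = \<phi> 0 + integral {0..t} (\<lambda>s. f s (x s, x (s - 1)))"
  using assms unfolding solution_on_def by auto

lemma solution_on_continuous_Icc:
  assumes "solution_on f \<phi> b x" "ereal T < b"
  shows "continuous_on {-1..T} x"
proof (rule continuous_on_subset[OF solution_onD(2)[OF assms(1)]])
  show "{-1..T} \<subseteq> {t. -1 \<le> t \<and> ereal t < b}"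
    using assms(2) by (auto intro: le_less_trans[of _ "ereal T"])
qed

lemma solution_on_diff:
  assumes "solution_on f \<phi> b x" "ereal t < b" "0 \<le> s" "s \<le> t"
  shows "x t - x s = integral {s..t} (\<lambda>r. f r (x r, x (r - 1)))"
proof -
  have s: "ereal s < b" using assms by (meson ereal_less_eq(3) le_less_trans)
  have "(\<lambda>r. f r (x r, x (r - 1))) integrable_on {0..t}"
    using solution_onD(4)[OF assms(1), of t] assms by (auto simp: absolutely_integrable_on_def)
  from Henstock_Kurzweil_Integration.integral_combine[OF assms(3,4) this]
  show ?thesis
    using solution_onD(5)[OF assms(1), of t] solution_onD(5)[OF assms(1), of s] assms s
    by (simp add: algebra_simps)
qed

text \<open>Boundedness makes the right-hand side integrable up to \<open>c\<close>, hence the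
  solution has a limit \<open>p\<close> there. Restarting from \<open>p\<close> is an equation
  without delay as long as the delayed argument stays in the past: the method of steps.\<close>

lemma bounded_solution_extends:
  fixes f :: "real \<Rightarrow> (real ^ 'n) \<times> (real ^ 'n) \<Rightarrow> real ^ 'n"
  assumes f: "f \<in> LC" and sol: "solution_on f \<phi> (ereal c) x"
    and bnd: "\<And>t. -1 \<le> t \<Longrightarrow> t < c \<Longrightarrow> norm (x t) \<le> R"
  obtains h y where "c < h" "solution_on f \<phi> (ereal h) y" "\<And>t. -1 \<le> t \<Longrightarrow> t < c \<Longrightarrow> y t = x t"
proof -
  have c: "0 < c" using solution_onD(1)[OF sol] by simp
  have R: "0 \<le> R" using bnd[of 0] c norm_ge_zero[of "x 0"] by linarith
  have cx: "continuous_on {-1..<c} x"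
    using solution_onD(2)[OF sol] by (simp add: atLeastLessThan_def atLeast_def lessThan_def Int_def)
  \<comment> \<open>Extension by zero, Borel and bounded by \<open>R\<close> on the whole
    line.\<close>
  define xt where "xt = (\<lambda>t. if t \<in> {-1..<c} then x t else 0)"
  have xt: "xt \<in> borel_measurable borel"
    unfolding xt_def using cx by (intro borel_measurable_continuous_on_if) auto
  have nxt: "norm (xt t) \<le> R" for t unfolding xt_def using bnd R by auto
  define g where "g = (\<lambda>s. f s (xt s, xt (s - 1)))"
  have xt1: "(\<lambda>s. xt (s - 1)) \<in> borel_measurable borel"
    using xt by measurable
  have g: "g \<in> borel_measurable lebesgue"
    unfolding g_def using f xt xt1 by (intro LC_compose_lebesgue borel_measurable_Pair)
  have gi: "g absolutely_integrable_on {0..c}"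
  proof -
    obtain m l where m: "\<And>a b. m absolutely_integrable_on {a..b}"
      and "\<And>a b. l absolutely_integrable_on {a..b}" "\<And>t. 0 \<le> m t" "\<And>t. 0 \<le> l t"
      and ae: "AE t in lebesgue. (\<forall>z\<in>cball 0 (R + R). norm (f t z) \<le> m t) \<and>
        (\<forall>z1\<in>cball 0 (R + R). \<forall>z2\<in>cball 0 (R + R). norm (f t z1 - f t z2) \<le> l t * norm (z1 - z2))"
      by (rule LC_bounds[OF f compact_cball[of 0 "R + R"]]) (rule that)
    have "(xt s, xt (s - 1)) \<in> cball 0 (R + R)" for s
      using norm_Pair_le[of "xt s" "xt (s - 1)"] nxt[of s] nxt[of "s - 1"] by simp
    then have "AE s in lebesgue. s \<in> {0..c} \<longrightarrow> norm (g s) \<le> m s"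
      using ae unfolding g_def by (auto elim!: eventually_mono)
    then show ?thesis by (rule absolutely_integrable_AE_bound[OF g _ m, rotated]) simp
  qed
  define p where "p = \<phi> 0 + integral {0..c} g"
  define F where "F = (\<lambda>s z. f s (z, xt (s - 1)))"
  have F: "(\<lambda>(s, z). F s z) \<in> borel_measurable borel"
  proof -
    have "(\<lambda>q. (fst q, (snd q, xt (fst q - 1)))) \<in> borel_measurable (borel :: (real \<times> (real ^ 'n)) measure)"
      by (intro borel_measurable_Pair measurable_compose[OF _ xt1] borel_measurable_continuous_onI continuous_intros)
    from measurable_compose[OF this LC_borel[OF f]] show ?thesis
      unfolding F_def by (simp add: case_prod_beta)
  qed
  define Q where "Q = norm p + 1 + R"
  obtain m l where m: "\<And>a b. m absolutely_integrable_on {a..b}"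
      and l: "\<And>a b. l absolutely_integrable_on {a..b}" and ml: "\<And>t. 0 \<le> m t" "\<And>t. 0 \<le> l t"
      and ae: "AE t in lebesgue. (\<forall>z\<in>cball 0 Q. norm (f t z) \<le> m t) \<and>
        (\<forall>z1\<in>cball 0 Q. \<forall>z2\<in>cball 0 Q. norm (f t z1 - f t z2) \<le> l t * norm (z1 - z2))"
    by (rule LC_bounds[OF f compact_cball[of 0 Q]]) (rule that)
  have inQ: "(z, xt s) \<in> cball 0 Q" if "z \<in> cball p 1" for z s
  proof -
    have "norm z \<le> norm p + 1"
      using that norm_triangle_ineq2[of z p] by (simp add: dist_norm norm_minus_commute)
    then show ?thesis using norm_Pair_le[of z "xt s"] nxt[of s] unfolding Q_def by simp
  qed
  \<comment> \<open>A step of length at most 1/2, less than the delay, keeps \<open>s - 1\<close>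
    below \<open>c\<close>, where \<open>xt\<close> agrees with \<open>x\<close>.\<close>
  have "AE t in lebesgue. t \<in> {c..c + 1 / 2} \<longrightarrow> (\<forall>z\<in>cball p 1. norm (F t z) \<le> m t) \<and>
        (\<forall>z1\<in>cball p 1. \<forall>z2\<in>cball p 1. norm (F t z1 - F t z2) \<le> l t * norm (z1 - z2))"
    using ae
  proof (eventually_elim, intro impI conjI ballI)
    fix t z1 z2 assume *: "(\<forall>z\<in>cball 0 Q. norm (f t z) \<le> m t) \<and>
        (\<forall>z1\<in>cball 0 Q. \<forall>z2\<in>cball 0 Q. norm (f t z1 - f t z2) \<le> l t * norm (z1 - z2))"
      and z: "z1 \<in> cball p 1" "z2 \<in> cball p 1"
    then have "norm (F t z1 - F t z2) \<le> l t * norm ((z1, xt (t - 1)) - (z2, xt (t - 1)))"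
      unfolding F_def using inQ by blast
    then show "norm (F t z1 - F t z2) \<le> l t * norm (z1 - z2)" by (simp add: norm_Pair)
  qed (use inQ in \<open>auto simp: F_def\<close>)
  then obtain h y where h: "c < h" "h \<le> c + 1 / 2"
    and yi: "\<And>t. t \<in> {c..h} \<Longrightarrow> (\<lambda>s. F s (y s)) absolutely_integrable_on {c..t}"
    and y: "\<And>t. t \<in> {c..h} \<Longrightarrow> y t = p + integral {c..t} (\<lambda>s. F s (y s))"
    by (rule caratheodory_local_existence[OF F _ m l ml, rotated]) auto
  define Y where "Y = (\<lambda>t. if t < c then x t else y t)"
  define G where "G = (\<lambda>s. f s (Y s, Y (s - 1)))"
  \<comment> \<open>At \<open>c\<close> itself \<open>Y\<close> has the value \<open>y c\<close>
    while \<open>xt\<close> is zero; one point does not affect the integrals.\<close>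
  have G1: "G s = g s" if "s \<in> {0..c} - {c}" for s
    using that c unfolding G_def g_def Y_def xt_def by auto
  have G2: "G s = F s (y s)" if "s \<in> {c..h}" for s
    using that c h unfolding G_def F_def Y_def xt_def by auto
  have Gi1: "G absolutely_integrable_on {0..c}"
    by (rule absolutely_integrable_spike[OF gi negligible_sing[of c] G1])
  have Gi2: "G absolutely_integrable_on {c..h}"
    using yi[of h] h G2 by (subst set_integrable_cong[OF refl refl G2]) auto
  have Gi: "G absolutely_integrable_on {0..t}" if "t \<le> h" for t
  proof (rule absolutely_integrable_on_subinterval)
    have "G absolutely_integrable_on {0..c} \<union> {c..h}"
      by (intro set_integrable_Un Gi1 Gi2) auto
    also have "{0..c} \<union> {c..h} = {0..h}" using c h by auto
    finally show "G absolutely_integrable_on {0..h}" .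
  qed (use that in auto)
  have Yint: "Y t = \<phi> 0 + integral {0..t} G" if t: "0 \<le> t" "t \<le> h" for t
  proof (cases "t < c")
    case True
    have "x t = \<phi> 0 + integral {0..t} (\<lambda>s. f s (x s, x (s - 1)))"
      using solution_onD(5)[OF sol] t True by simp
    also have "integral {0..t} (\<lambda>s. f s (x s, x (s - 1))) = integral {0..t} G"
      using True t by (intro integral_cong) (auto simp: G_def Y_def)
    finally show ?thesis using True unfolding Y_def by simp
  next
    case False
    have "integral {0..c} G = integral {0..c} g"
      by (rule integral_spike[OF negligible_sing[of c]]) (use G1 in auto)
    moreover have "integral {c..t} G = integral {c..t} (\<lambda>s. F s (y s))"
      using G2 t by (intro integral_cong) auto
    moreover have "integral {0..c} G + integral {c..t} G = integral {0..t} G"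
      using Gi[of t] c False t
      by (intro Henstock_Kurzweil_Integration.integral_combine) (auto simp: absolutely_integrable_on_def)
    moreover have "y t = p + integral {c..t} (\<lambda>s. F s (y s))" using y False t by auto
    ultimately show ?thesis using False unfolding Y_def p_def by (simp add: algebra_simps)
  qed
  show thesis
  proof (rule that[OF h(1)])
    show "Y t = x t" if "t < c" for t using that unfolding Y_def by simp
    \<comment> \<open>Continuity across \<open>c\<close> is read off from the integral equation for
      \<open>Y\<close>.\<close>
    have "continuous_on {0..h} (\<lambda>t. \<phi> 0 + integral {0..t} G)"
      using Gi[of h] by (intro continuous_intros indefinite_integral_continuous_1) (auto simp: absolutely_integrable_on_def)
    then have "continuous_on {0..h} Y"
      using Yint by (subst continuous_on_cong[OF refl]) auto
    moreover have "continuous_on {-1..0} x" using cx c by (auto intro: continuous_on_subset)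
    then have "continuous_on {-1..0} Y"
      using c by (subst continuous_on_cong[OF refl, of _ _ x]) (auto simp: Y_def)
    ultimately have "continuous_on ({-1..0} \<union> {0..h}) Y"
      by (intro continuous_on_closed_Un) auto
    then have "continuous_on {t. -1 \<le> t \<and> ereal t < ereal h} Y"
      by (rule continuous_on_subset) auto
    moreover have "Y t = \<phi> t" if "t \<in> {-1..0}" for t
      using solution_onD(3)[OF sol that] that c unfolding Y_def by auto
    ultimately show "solution_on f \<phi> (ereal h) Y"
      unfolding solution_on_def using Yint Gi c h unfolding G_def by auto
  qed
qed

text \<open>If \<open>b\<close> were at most \<open>T\<close>, it would be finite and the bound
  would hold on the whole domain of \<open>x\<close>, so \<open>x\<close> could be continued past
  \<open>b\<close> against maximality.\<close>

lemma maximal_solution_bounded_imp_global: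
  fixes f :: "real \<Rightarrow> (real ^ 'n) \<times> (real ^ 'n) \<Rightarrow> real ^ 'n"
  assumes f: "f \<in> LC" and max: "maximal_solution f \<phi> b x"
    and bnd: "\<And>t. -1 \<le> t \<Longrightarrow> t \<le> T \<Longrightarrow> ereal t < b \<Longrightarrow> norm (x t) \<le> R"
  shows "ereal T < b"
proof (rule ccontr)
  assume "\<not> ereal T < b"
  then have bT: "b \<le> ereal T" by simp
  have sol: "solution_on f \<phi> b x" using max unfolding maximal_solution_def by blast
  obtain c where c: "b = ereal c" using solution_onD(1)[OF sol] bT by (cases b) auto
  have "norm (x t) \<le> R" if "-1 \<le> t" "t < c" for t
    using bnd[of t] that bT unfolding c by simp
  then obtain h y where h: "c < h" "solution_on f \<phi> (ereal h) y" "\<And>t. -1 \<le> t \<Longrightarrow> t < c \<Longrightarrow> y t = x t"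
    by (rule bounded_solution_extends[OF f sol[unfolded c]]) (assumption, assumption, rule that)
  then have "ereal h = b"
    using max unfolding maximal_solution_def c by (auto dest!: spec[of _ "ereal h"])
  with h(1) show False unfolding c by simp
qed

section \<open>Gronwall inequality with delay and stability\<close>

text \<open>Time is cut where \<open>K\<close> reaches multiples of 1/4. If \<open>d\<close> is at
  most \<open>B\<close> up to a cut, its maximum \<open>M\<close> up to the next one satisfies
  \<open>M \<le> B + M / 2 + \<epsilon>\<close>, and \<open>\<epsilon> \<le> A \<le> B\<close> gives
  \<open>M \<le> 4 * B\<close>. Only the number \<open>m\<close> of cuts enters the constant, not
  their position, so it is the same for all kernels with a common bound on the integral.\<close>

lemma delay_gronwall:
  fixes d K :: "real \<Rightarrow> real"
  assumes d: "continuous_on {-1..\<tau>} d" "\<And>t. t \<in> {-1..\<tau>} \<Longrightarrow> 0 \<le> d t"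
    and dA: "\<And>t. t \<in> {-1..0} \<Longrightarrow> d t \<le> A" and A: "\<epsilon> \<le> A" "0 \<le> A"
    and K: "continuous_on {0..\<tau>} K" "mono_on {0..\<tau>} K" "K 0 = 0"
    and step: "\<And>s t Y. \<lbrakk>0 \<le> s; s \<le> t; t \<le> \<tau>; \<And>r. r \<in> {-1..t} \<Longrightarrow> d r \<le> Y\<rbrakk>
        \<Longrightarrow> d t \<le> d s + 2 * Y * (K t - K s) + \<epsilon>"
    and t: "0 \<le> t" "t \<le> \<tau>" "K t \<le> real m / 4" and r: "r \<in> {-1..t}"
  shows "d r \<le> 4 ^ m * (4 * A)"
proof -
  have *: "d r \<le> 4 * B"
    if \<sigma>: "0 \<le> \<sigma>" "\<sigma> \<le> t" "t \<le> \<tau>" and B: "A \<le> B" "\<And>r. r \<in> {-1..\<sigma>} \<Longrightarrow> d r \<le> B"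
      and Kt: "K t - K \<sigma> \<le> 1 / 4" and r: "r \<in> {-1..t}" for t \<sigma> B r
  proof -
    have "continuous_on {-1..t} d"
      using d(1) \<sigma> by (auto intro: continuous_on_subset)
    \<comment> \<open>The maximum is taken over the entire past, including the initial interval, so
      \<open>d p\<close> is an admissible \<open>Y\<close> and bounds the delayed term too.\<close>
    then obtain p where p: "p \<in> {-1..t}" and max: "\<And>r. r \<in> {-1..t} \<Longrightarrow> d r \<le> d p"
      using continuous_attains_sup[of "{-1..t}" d] \<sigma> by auto
    have "d p \<le> 4 * B"
    proof (cases "p \<le> \<sigma>")
      case True
      then have "d p \<le> B" using B(2) p by auto
      then show ?thesis using A B(1) by linarith
    next
      case False
      have "d p \<le> d \<sigma> + 2 * d p * (K p - K \<sigma>) + \<epsilon>"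
        using False p \<sigma> max by (intro step) auto
      moreover have "K p \<le> K t"
        using K(2) False p \<sigma> by (auto simp: mono_on_def)
      then have "2 * d p * (K p - K \<sigma>) \<le> 2 * d p * (1 / 4)"
        using d(2)[of p] p \<sigma> Kt by (intro mult_left_mono) auto
      moreover have "d \<sigma> \<le> B" using B(2) \<sigma> by auto
      ultimately show ?thesis using A B(1) by linarith
    qed
    with max[OF r] show ?thesis by linarith
  qed
  have "\<forall>r\<in>{-1..t}. d r \<le> 4 ^ m * (4 * A)"
    using t
  proof (induction m arbitrary: t)
    case 0
    then show ?case
      using *[of 0 t A] dA K(3) by auto
  next
    case (Suc m)
    have pow: "A \<le> 4 ^ m * (4 * A)"
      using A mult_mono[of 1 "4 ^ m :: real" A "4 * A"] by simp
    show ?case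
    proof (cases "K t \<le> real m / 4")
      case True
      then have "\<forall>r\<in>{-1..t}. d r \<le> 4 ^ m * (4 * A)" using Suc by blast
      moreover have "4 ^ m * (4 * A) \<le> 4 ^ Suc m * (4 * A)" using pow A by simp
      ultimately show ?thesis by (meson order_trans)
    next
      case False
      have "continuous_on {0..t} K" using K(1) Suc by (auto intro: continuous_on_subset)
      then obtain \<sigma> where \<sigma>: "0 \<le> \<sigma>" "\<sigma> \<le> t" "K \<sigma> = real m / 4"
        using IVT'[of K 0 "real m / 4" t] False K(3) Suc by auto
      then have "\<forall>r\<in>{-1..\<sigma>}. d r \<le> 4 ^ m * (4 * A)" using Suc by auto
      then have "d r \<le> 4 * (4 ^ m * (4 * A))" if "r \<in> {-1..t}" for r
        using \<sigma> Suc.prems pow that by (intro *[of \<sigma> t]) (auto simp: field_simps)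
      then show ?thesis by simp
    qed
  qed
  with r show ?thesis by blast
qed

text \<open>Subtracting the integral equations puts the difference under the delayed Gronwall
  inequality. Inserting the resulting sup bound into the pointwise estimate of the right-hand sides
  then yields the second claim, which is the derivative part of the \<open>C11\<close> norm.\<close>

lemma solution_pair_estimate:
  fixes f g :: "real \<Rightarrow> (real ^ 'n) \<times> (real ^ 'n) \<Rightarrow> real ^ 'n"
  assumes x: "solution_on f \<phi> b x" and y: "solution_on g \<psi> b' y"
    and \<tau>: "0 \<le> \<tau>" "ereal \<tau> < b" "ereal \<tau> < b'"
    and A: "\<And>s. s \<in> {-1..0} \<Longrightarrow> norm (\<psi> s - \<phi> s) \<le> A" "\<epsilon> \<le> A"
    and k: "k absolutely_integrable_on {0..\<tau>}" "\<And>s. 0 \<le> k s" "integral {0..\<tau>} k \<le> C"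
    and h: "h absolutely_integrable_on {0..\<tau>}" "\<And>s. 0 \<le> h s" "integral {0..\<tau>} h \<le> \<epsilon>"
    and ae: "AE s in lebesgue. s \<in> {0..\<tau>} \<longrightarrow>
       norm (g s (y s, y (s - 1)) - f s (x s, x (s - 1)))
         \<le> k s * (norm (y s - x s) + norm (y (s - 1) - x (s - 1))) + h s"
    and m: "C \<le> real m / 4"
  shows "\<And>r. r \<in> {-1..\<tau>} \<Longrightarrow> norm (y r - x r) \<le> 4 ^ m * (4 * A)"
    and "integral {0..\<tau>} (\<lambda>s. norm (g s (y s, y (s - 1)) - f s (x s, x (s - 1)))) \<le> 2 * (4 ^ m * (4 * A)) * C + \<epsilon>"
proof -
  let ?d = "\<lambda>s. norm (y s - x s)"
  let ?D = "\<lambda>s. g s (y s, y (s - 1)) - f s (x s, x (s - 1))"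
  define K where "K = (\<lambda>t. integral {0..t} k)"
  have "norm (\<psi> 0 - \<phi> 0) \<le> A" using A(1) by simp
  then have A0: "0 \<le> A" by (rule order_trans[OF norm_ge_zero])
  have gi: "(\<lambda>s. g s (y s, y (s - 1))) absolutely_integrable_on {0..\<tau>}"
    and fi: "(\<lambda>s. f s (x s, x (s - 1))) absolutely_integrable_on {0..\<tau>}"
    using solution_onD(4)[OF y] solution_onD(4)[OF x] \<tau> by auto
  have Di: "?D absolutely_integrable_on {0..\<tau>}"
    using gi fi by (rule set_integral_diff)
  have KK: "integral {s..t} k = K t - K s" if "0 \<le> s" "s \<le> t" "t \<le> \<tau>" for s t
  proof -
    have "k absolutely_integrable_on {0..t}" using k(1) that by (auto intro: absolutely_integrable_on_subinterval)
    then show ?thesis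
      using Henstock_Kurzweil_Integration.integral_combine[of 0 s t k] that
      unfolding K_def by (simp add: absolutely_integrable_on_def)
  qed
  have bnd: "integral {s..t} (\<lambda>r. norm (?D r)) \<le> 2 * Y * (K t - K s) + \<epsilon>"
    and nbnd: "norm (integral {s..t} ?D) \<le> 2 * Y * (K t - K s) + \<epsilon>"
    if st: "0 \<le> s" "s \<le> t" "t \<le> \<tau>" and Y: "\<And>r. r \<in> {-1..t} \<Longrightarrow> ?d r \<le> Y" for s t Y
  proof -
    have sub: "k absolutely_integrable_on {s..t}" "h absolutely_integrable_on {s..t}" "?D absolutely_integrable_on {s..t}"
      using k(1) h(1) Di st by (auto intro: absolutely_integrable_on_subinterval)
    have M: "(\<lambda>r. k r * (2 * Y) + h r) absolutely_integrable_on {s..t}"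
      using sub by (intro set_integral_add(1) set_integrable_mult_left) auto
    have le: "AE r in lebesgue. r \<in> {s..t} \<longrightarrow> norm (?D r) \<le> k r * (2 * Y) + h r"
      using ae
    proof (eventually_elim, intro impI)
      fix r assume r: "r \<in> {s..t}" and "r \<in> {0..\<tau>} \<longrightarrow> norm (?D r) \<le> k r * (?d r + ?d (r - 1)) + h r"
      then have "norm (?D r) \<le> k r * (?d r + ?d (r - 1)) + h r" using st by auto
      moreover have "k r * (?d r + ?d (r - 1)) \<le> k r * (2 * Y)"
        using Y[of r] Y[of "r - 1"] r st k(2) by (intro mult_left_mono) auto
      ultimately show "norm (?D r) \<le> k r * (2 * Y) + h r" by linarith
    qed
    have "integral {s..t} (\<lambda>r. k r * (2 * Y) + h r) = integral {s..t} k * (2 * Y) + integral {s..t} h"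
      using sub by (subst Henstock_Kurzweil_Integration.integral_add)
        (auto simp: absolutely_integrable_on_def intro: integrable_on_mult_left)
    moreover have "integral {s..t} h \<le> integral {0..\<tau>} h"
      using sub h st by (intro integral_subset_le) (auto simp: absolutely_integrable_on_def)
    ultimately have "integral {s..t} (\<lambda>r. k r * (2 * Y) + h r) \<le> 2 * Y * (K t - K s) + \<epsilon>"
      using KK[OF st] h(3) by (simp add: algebra_simps)
    then show "integral {s..t} (\<lambda>r. norm (?D r)) \<le> 2 * Y * (K t - K s) + \<epsilon>"
      "norm (integral {s..t} ?D) \<le> 2 * Y * (K t - K s) + \<epsilon>"
      using integral_norm_mono_AE[OF sub(3) M le] norm_integral_le_integral_AE[OF sub(3) M le] by linarith+
  qed
  have "?d r \<le> 4 ^ m * (4 * A)" if r: "r \<in> {-1..\<tau>}" for r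
  proof (rule delay_gronwall[where d = ?d and A = A and r = r and K = K and \<epsilon> = \<epsilon> and \<tau> = \<tau> and t = \<tau>])
    show "continuous_on {-1..\<tau>} ?d"
      using solution_on_continuous_Icc[OF x \<tau>(2)] solution_on_continuous_Icc[OF y \<tau>(3)] by (intro continuous_intros)
    show "?d t \<le> A" if "t \<in> {-1..0}" for t
      using A(1)[OF that] solution_onD(3)[OF x that] solution_onD(3)[OF y that] by simp
    show "continuous_on {0..\<tau>} K"
      unfolding K_def using k(1) by (intro indefinite_integral_continuous_1) (auto simp: absolutely_integrable_on_def)
    show "mono_on {0..\<tau>} K"
    proof (rule mono_onI)
      fix s t assume st: "s \<in> {0..\<tau>}" "t \<in> {0..\<tau>}" "s \<le> t"
      have "k absolutely_integrable_on {s..t}"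
        using k(1) st by (auto intro: absolutely_integrable_on_subinterval)
      then have "0 \<le> integral {s..t} k"
        using k(2) by (intro Henstock_Kurzweil_Integration.integral_nonneg) (auto simp: absolutely_integrable_on_def)
      then show "K s \<le> K t" using KK[of s t] st by simp
    qed
    show "K \<tau> \<le> real m / 4" using k(3) m unfolding K_def by linarith
    show "?d t \<le> ?d s + 2 * Y * (K t - K s) + \<epsilon>"
      if st: "0 \<le> s" "s \<le> t" "t \<le> \<tau>" and Y: "\<And>r. r \<in> {-1..t} \<Longrightarrow> ?d r \<le> Y" for s t Y
    proof -
      have tb: "ereal t < b" "ereal t < b'" using \<tau> st by (meson ereal_less_eq(3) le_less_trans)+
      have "integral {s..t} ?D = integral {s..t} (\<lambda>s. g s (y s, y (s - 1))) - integral {s..t} (\<lambda>s. f s (x s, x (s - 1)))"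
      proof (rule Henstock_Kurzweil_Integration.integral_diff)
        show "(\<lambda>s. g s (y s, y (s - 1))) integrable_on {s..t}" "(\<lambda>s. f s (x s, x (s - 1))) integrable_on {s..t}"
          using absolutely_integrable_on_subinterval[OF gi, of s t] absolutely_integrable_on_subinterval[OF fi, of s t] st
          by (auto simp: absolutely_integrable_on_def)
      qed
      also have "\<dots> = (y t - y s) - (x t - x s)"
        using solution_on_diff[OF x tb(1) st(1,2)] solution_on_diff[OF y tb(2) st(1,2)] by simp
      finally have "y t - x t = (y s - x s) + integral {s..t} ?D" by simp
      then have "?d t \<le> ?d s + norm (integral {s..t} ?D)"
        using norm_triangle_ineq[of "y s - x s" "integral {s..t} ?D"] by simp
      with nbnd[OF st Y] show ?thesis by linarith
    qed
  qed (use A A0 \<tau> r in \<open>auto simp: K_def\<close>)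
  then show d: "\<And>r. r \<in> {-1..\<tau>} \<Longrightarrow> ?d r \<le> 4 ^ m * (4 * A)" .
  have "integral {0..\<tau>} (\<lambda>r. norm (?D r)) \<le> 2 * (4 ^ m * (4 * A)) * (K \<tau> - K 0) + \<epsilon>"
    using \<tau>(1) d by (intro bnd) auto
  moreover have "2 * (4 ^ m * (4 * A)) * (K \<tau> - K 0) \<le> 2 * (4 ^ m * (4 * A)) * C"
    using k(3) A0 unfolding K_def by (intro mult_left_mono) auto
  ultimately show "integral {0..\<tau>} (\<lambda>s. norm (?D s)) \<le> 2 * (4 ^ m * (4 * A)) * C + \<epsilon>" by linarith
qed

text \<open>
  \<open>y\<close> follows \<open>g\<close> on \<open>[0, b)\<close> and is compared with \<open>x\<close>, which follows \<open>f\<close>: \<open>k\<close> is the kernel for Gronwall and \<open>h\<close> the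
  small error. Both may depend on the time \<open>\<tau>\<close> up to which \<open>y\<close> has stayed close to \<open>x\<close>.
\<close>

definition defect_bound ::
    "real \<Rightarrow> real \<Rightarrow> real \<Rightarrow> (real \<Rightarrow> (real ^ 'n) \<times> (real ^ 'n) \<Rightarrow> real ^ 'n) \<Rightarrow> (real \<Rightarrow> real ^ 'n) \<Rightarrow>
     (real \<Rightarrow> (real ^ 'n) \<times> (real ^ 'n) \<Rightarrow> real ^ 'n) \<Rightarrow> (real \<Rightarrow> real ^ 'n) \<Rightarrow> ereal \<Rightarrow> bool" where
  "defect_bound T C \<epsilon> f x g y b \<longleftrightarrow>
     (\<forall>\<tau>. 0 \<le> \<tau> \<longrightarrow> \<tau> \<le> T \<longrightarrow> ereal \<tau> < b \<longrightarrow> (\<forall>s\<in>{-1..\<tau>}. norm (y s - x s) \<le> 1) \<longrightarrow>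
        (\<exists>k h. k absolutely_integrable_on {0..\<tau>} \<and> h absolutely_integrable_on {0..\<tau>} \<and>
          (\<forall>s. 0 \<le> k s) \<and> (\<forall>s. 0 \<le> h s) \<and> integral {0..\<tau>} k \<le> C \<and> integral {0..\<tau>} h \<le> \<epsilon> \<and>
          (AE s in lebesgue. s \<in> {0..\<tau>} \<longrightarrow>
             norm (g s (y s, y (s - 1)) - f s (x s, x (s - 1)))
               \<le> k s * (norm (y s - x s) + norm (y (s - 1) - x (s - 1))) + h s)))"

lemma solution_sequence_stability:
  fixes f :: "real \<Rightarrow> (real ^ 'n) \<times> (real ^ 'n) \<Rightarrow> real ^ 'n"
  assumes fs: "\<And>n. fs n \<in> LC"
    and xs: "\<And>n. maximal_solution (fs n) (\<phi>s n) (bs n) (xs n)"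
    and x: "solution_on f \<phi> b x" and T: "0 \<le> T" "ereal T < b"
    and \<phi>s: "uniform_limit {-1..0} \<phi>s \<phi> sequentially"
    and est: "\<And>\<epsilon>. \<epsilon> > 0 \<Longrightarrow> \<forall>\<^sub>F n in sequentially. defect_bound T C \<epsilon> f x (fs n) (xs n) (bs n)"
    and e: "e > 0"
  shows "\<forall>\<^sub>F n in sequentially. ereal T < bs n \<and> (\<forall>s\<in>{-1..T}. norm (xs n s - x s) \<le> e) \<and>
    integral {0..T} (\<lambda>s. norm (fs n s (xs n s, xs n (s - 1)) - f s (x s, x (s - 1)))) \<le> e"
proof -
  \<comment> \<open>\<open>defect_bound\<close> leaves the sign of \<open>C\<close> open, hence
    \<open>max C 0\<close>.\<close>
  obtain m :: nat where "4 * max C 0 \<le> real m" using real_arch_simple by blast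
  then have m: "max C 0 \<le> real m / 4" by simp
  \<comment> \<open>The cap 1/2 is strictly below the tube radius 1; this gap closes the
    continuation argument.\<close>
  define e0 where "e0 = min e (1 / 2)"
  \<comment> \<open>With \<open>M = 4 ^ m * (4 * A)\<close> the choice means
    \<open>M * (2 * max C 0 + 2) = e0\<close>, so both the sup bound \<open>M\<close> and the
    integral bound \<open>2 * M * max C 0 + A\<close> are at most \<open>e0\<close>. The same
    \<open>A\<close> bounds the initial distance and the defect.\<close>
  define A where "A = e0 / (4 * 4 ^ m * (2 * max C 0 + 2))"
  have e0: "0 < e0" "e0 \<le> e" "e0 \<le> 1 / 2" unfolding e0_def using e by auto
  have pos: "0 < 4 * 4 ^ m * (2 * max C 0 + 2)" by (intro mult_pos_pos) auto
  have A: "0 < A" unfolding A_def using e0 pos by simp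
  have AM: "4 ^ m * (4 * A) * (2 * max C 0 + 2) = e0" unfolding A_def using pos by (simp add: field_simps)
  have M0: "A \<le> 4 ^ m * (4 * A)" using A mult_mono[of 1 "4 ^ m :: real" A "4 * A"] by simp
  have nonneg: "0 \<le> 2 * (4 ^ m * (4 * A)) * max C 0"
    using A by (intro mult_nonneg_nonneg) auto
  have "2 * (4 ^ m * (4 * A)) * max C 0 + 2 * (4 ^ m * (4 * A)) = e0"
    using AM by (simp only: algebra_simps)
  with nonneg A M0 have M1: "4 ^ m * (4 * A) \<le> e0" and M2: "2 * (4 ^ m * (4 * A)) * max C 0 + A \<le> e0"
    by linarith+
  have "\<forall>\<^sub>F n in sequentially. \<forall>s\<in>{-1..0}. dist (\<phi>s n s) (\<phi> s) < A"
    using \<phi>s A by (rule uniform_limitD)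
  moreover note est[OF A]
  ultimately show ?thesis
  proof eventually_elim
    case (elim n)
    let ?d = "\<lambda>s. norm (xs n s - x s)"
    have sn: "solution_on (fs n) (\<phi>s n) (bs n) (xs n)" using xs[of n] unfolding maximal_solution_def by blast
    have \<phi>A: "norm (\<phi>s n s - \<phi> s) \<le> A" if "s \<in> {-1..0}" for s
      using elim(1) that by (auto simp: dist_norm less_imp_le)
    have close: "(\<forall>r\<in>{-1..\<tau>}. ?d r \<le> e0) \<and>
      integral {0..\<tau>} (\<lambda>s. norm (fs n s (xs n s, xs n (s - 1)) - f s (x s, x (s - 1)))) \<le> e0"
      if \<tau>: "0 \<le> \<tau>" "\<tau> \<le> T" "ereal \<tau> < bs n" "\<forall>s\<in>{-1..\<tau>}. ?d s \<le> 1" for \<tau>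
    proof -
      obtain k h where kh: "k absolutely_integrable_on {0..\<tau>}" "\<And>s. 0 \<le> k s" "integral {0..\<tau>} k \<le> max C 0"
        "h absolutely_integrable_on {0..\<tau>}" "\<And>s. 0 \<le> h s" "integral {0..\<tau>} h \<le> A"
        and ae: "AE s in lebesgue. s \<in> {0..\<tau>} \<longrightarrow>
             norm (fs n s (xs n s, xs n (s - 1)) - f s (x s, x (s - 1)))
               \<le> k s * (?d s + ?d (s - 1)) + h s"
        using elim(2)[unfolded defect_bound_def, rule_format, OF \<tau>(1-3)] \<tau>(4) by fastforce
      have "ereal \<tau> < b" using \<tau>(2) T(2) by (meson ereal_less_eq(3) le_less_trans)
      note E = solution_pair_estimate[OF x sn \<tau>(1) this \<tau>(3) \<phi>A order_refl kh ae m]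
      show ?thesis
      proof (intro conjI ballI)
        show "?d r \<le> e0" if "r \<in> {-1..\<tau>}" for r using E(1)[OF _ that] M1 by simp
      qed (use E(2) M2 in simp)
    qed
    have less1: "?d t < 1" if t: "-1 \<le> t" "t \<le> T" "ereal t < bs n" for t
    proof (rule ccontr)
      assume "\<not> ?d t < 1"
      then have d1: "1 \<le> ?d t" by simp
      have d0: "?d s < 1" if s: "s \<in> {-1..0}" for s
        using \<phi>A[OF s] solution_onD(3)[OF sn s] solution_onD(3)[OF x s] M0 M1 e0 by simp
      have t0: "0 < t" using d0[of t] d1 t by force
      have cont: "continuous_on {-1..t} ?d"
        using solution_on_continuous_Icc[OF sn t(3)] solution_on_continuous_Icc[OF x T(2)] t(2)
        by (intro continuous_intros) (auto intro: continuous_on_subset)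
      \<comment> \<open>The least element \<tau> of this compact set is the first time at which the
        distance reaches 1.\<close>
      define Z where "Z = {s \<in> {-1..t}. 1 \<le> ?d s}"
      have "compact Z"
        unfolding compact_eq_bounded_closed
      proof
        show "bounded Z" unfolding Z_def by (rule bounded_subset[OF bounded_closed_interval[of "-1" t]]) auto
        show "closed Z" unfolding Z_def by (intro continuous_on_closed_Collect_le cont continuous_on_const closed_atLeastAtMost)
      qed
      moreover have "Z \<noteq> {}" unfolding Z_def using d1 t0 by auto
      ultimately obtain \<tau> where \<tau>: "\<tau> \<in> Z" "\<And>s. s \<in> Z \<Longrightarrow> \<tau> \<le> s"
        using continuous_attains_inf[of Z "\<lambda>s. s"] by auto
      have \<tau>0: "0 < \<tau>" "\<tau> \<le> t" "1 \<le> ?d \<tau>" using \<tau>(1) d0[of \<tau>] unfolding Z_def by force+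
      have lt: "?d s < 1" if "s \<in> {-1..<\<tau>}" for s
        using \<tau>(2)[of s] that \<tau>0 unfolding Z_def by force
      \<comment> \<open>The defect bound is available only if the distance is at most 1 on the
        closed interval up to \<tau>. A jump above 1 at \<tau> is excluded by the intermediate value
        theorem; then the distance at \<tau> would be both at least 1 and at most
        \<open>e0\<close>.\<close>
      have "?d \<tau> \<le> 1"
      proof (rule ccontr)
        assume "\<not> ?d \<tau> \<le> 1"
        then obtain s where s: "-1 \<le> s" "s \<le> \<tau>" "?d s = 1"
          using IVT'[of ?d "-1" 1 \<tau>] d0[of "-1"] \<tau>0 continuous_on_subset[OF cont, of "{-1..\<tau>}"] by auto
        then show False using lt[of s] \<open>\<not> ?d \<tau> \<le> 1\<close> by (cases "s = \<tau>") auto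
      qed
      then have "\<forall>s\<in>{-1..\<tau>}. ?d s \<le> 1" using lt by (force simp: less_imp_le le_less)
      moreover have "ereal \<tau> < bs n" using \<tau>0 t(3) by (meson ereal_less_eq(3) le_less_trans)
      ultimately have "?d \<tau> \<le> e0" using close[of \<tau>] \<tau>0 t(2) by auto
      then show False using \<tau>0 e0 by linarith
    qed
    have "compact (x ` {-1..T})"
      using solution_on_continuous_Icc[OF x T(2)] by (intro compact_continuous_image) auto
    then have "bounded (x ` {-1..T})" by (rule compact_imp_bounded)
    then obtain R where R: "\<forall>y\<in>x ` {-1..T}. norm y \<le> R"
      unfolding bounded_iff ..
    have Tb: "ereal T < bs n"
    proof (rule maximal_solution_bounded_imp_global[OF fs xs])
      fix t assume t: "-1 \<le> t" "t \<le> T" "ereal t < bs n"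
      have "norm (xs n t) \<le> norm (x t) + ?d t" using norm_triangle_ineq[of "x t" "xs n t - x t"] by simp
      then show "norm (xs n t) \<le> R + 1" using less1[OF t] R t by force
    qed
    have "\<forall>s\<in>{-1..T}. ?d s \<le> 1"
    proof
      fix s assume s: "s \<in> {-1..T}"
      then have "ereal s < bs n" using Tb by (auto intro: le_less_trans[of _ "ereal T"])
      then show "?d s \<le> 1" using less1[of s] s by auto
    qed
    then show ?case using close[of T] T(1) Tb e0 by fastforce
  qed
qed

section \<open>The space of functions with integrable derivative\<close>

lemma AE_lebesgue_neq: "AE t in lebesgue. t \<noteq> (a :: 'a :: euclidean_space)"
  by (rule AE_I'[of "{a}"]) (auto simp: null_setsI)

lemma at_within_Icc_interior: "t \<in> {a<..<b} \<Longrightarrow> at t within {a..b} = at (t :: real)"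
  by (rule at_within_Icc_at) auto

text \<open>One-sided and two-sided derivatives differ at the two endpoints only. The two-sided form
  no longer mentions the interval, so it can be restricted and glued.\<close>

lemma C11_Icc_iff:
  "x \<in> C11 {a..b} \<longleftrightarrow> continuous_on {a..b} x \<and>
     (AE t in lebesgue. t \<in> {a<..<b} \<longrightarrow> x differentiable (at t)) \<and>
     (\<lambda>t. vector_derivative x (at t)) absolutely_integrable_on {a..b}"
proof -
  have "(AE t in lebesgue. t \<in> {a..b} \<longrightarrow> x differentiable (at t within {a..b})) \<longleftrightarrow>
        (AE t in lebesgue. t \<in> {a<..<b} \<longrightarrow> x differentiable (at t))"
    (is "?l = ?r")
  proof
    assume ?l then show ?r
      by (eventually_elim) (auto simp: at_within_Icc_interior)
  next
    assume ?r
    with AE_lebesgue_neq[of a] AE_lebesgue_neq[of b] show ?l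
      by eventually_elim (auto simp: at_within_Icc_interior less_le)
  qed
  moreover have "(\<lambda>t. vector_derivative x (at t within {a..b})) absolutely_integrable_on {a..b} \<longleftrightarrow>
      (\<lambda>t. vector_derivative x (at t)) absolutely_integrable_on {a..b}"
    by (rule absolutely_integrable_spike_eq[of "{a, b}"]) (auto simp: at_within_Icc_at less_le)
  ultimately show ?thesis unfolding C11_def by auto
qed

lemma C11_norm_Icc:
  "C11_norm {a..b} x = (SUP t\<in>{a..b}. ennreal (norm (x t))) +
     (\<integral>\<^sup>+ t\<in>{a..b}. ennreal (norm (vector_derivative x (at t))) \<partial>lebesgue)"
proof -
  have "(\<integral>\<^sup>+ t\<in>{a..b}. ennreal (norm (vector_derivative x (at t within {a..b}))) \<partial>lebesgue) =
        (\<integral>\<^sup>+ t\<in>{a..b}. ennreal (norm (vector_derivative x (at t))) \<partial>lebesgue)"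
  proof (rule nn_integral_cong_AE)
    show "AE t in lebesgue. ennreal (norm (vector_derivative x (at t within {a..b}))) * indicator {a..b} t =
       ennreal (norm (vector_derivative x (at t))) * indicator {a..b} t"
      using AE_lebesgue_neq[of a] AE_lebesgue_neq[of b]
      by eventually_elim (auto simp: at_within_Icc_at less_le split: split_indicator)
  qed
  then show ?thesis unfolding C11_norm_def by simp
qed

lemma C11_tendsto_subinterval:
  fixes x :: "real \<Rightarrow> real ^ 'n"
  assumes "C11_tendsto {a..b} xs x" and sub: "a \<le> c" "d \<le> b"
  shows "C11_tendsto {c..d} xs x"
proof -
  have sub': "{c..d} \<subseteq> {a..b}" "{c<..<d} \<subseteq> {a<..<b}" using sub by auto
  have mem: "y \<in> C11 {c..d}" if "y \<in> C11 {a..b}" for y :: "real \<Rightarrow> real ^ 'n"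
    using that sub' unfolding C11_Icc_iff
    by (auto intro: continuous_on_subset absolutely_integrable_on_subinterval elim!: eventually_mono)
  have le: "C11_norm {c..d} y \<le> C11_norm {a..b} y" for y :: "real \<Rightarrow> real ^ 'n"
    unfolding C11_norm_Icc using sub'
    by (intro add_mono SUP_subset_mono nn_integral_mono) (auto split: split_indicator)
  have "(\<lambda>n. C11_norm {c..d} (\<lambda>t. xs n t - x t)) \<longlonglongrightarrow> 0"
    by (rule tendsto_sandwich[of "\<lambda>_. 0" _ _ "\<lambda>n. C11_norm {a..b} (\<lambda>t. xs n t - x t)"])
      (use assms le in \<open>auto simp: C11_tendsto_def always_eventually\<close>)
  with assms mem show ?thesis unfolding C11_tendsto_def by (auto elim: eventually_mono)
qed

text \<open>The derivative may fail to exist at the junction \<open>b\<close>, a null set. The sup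
  norm over the union is a maximum and is bounded by the sum.\<close>

lemma C11_tendsto_union:
  fixes x :: "real \<Rightarrow> real ^ 'n"
  assumes 1: "C11_tendsto {a..b} xs x" and 2: "C11_tendsto {b..c} xs x" and abc: "a \<le> b" "b \<le> c"
  shows "C11_tendsto {a..c} xs x"
proof -
  have un: "{a..c} = {a..b} \<union> {b..c}" using abc by auto
  have mem: "y \<in> C11 {a..c}" if y: "y \<in> C11 {a..b}" "y \<in> C11 {b..c}" for y :: "real \<Rightarrow> real ^ 'n"
    unfolding C11_Icc_iff
  proof (intro conjI)
    show "continuous_on {a..c} y"
      unfolding un using y by (intro continuous_on_closed_Un) (auto simp: C11_Icc_iff)
    show "(\<lambda>t. vector_derivative y (at t)) absolutely_integrable_on {a..c}"
      unfolding un using y by (intro set_integrable_Un) (auto simp: C11_Icc_iff)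
    have "AE t in lebesgue. t \<in> {a<..<b} \<longrightarrow> y differentiable (at t)"
      "AE t in lebesgue. t \<in> {b<..<c} \<longrightarrow> y differentiable (at t)" using y by (auto simp: C11_Icc_iff)
    with AE_lebesgue_neq[of b] show "AE t in lebesgue. t \<in> {a<..<c} \<longrightarrow> y differentiable (at t)"
      by eventually_elim auto
  qed
  have le: "C11_norm {a..c} y \<le> C11_norm {a..b} y + C11_norm {b..c} y"
    if y: "y \<in> C11 {a..b}" "y \<in> C11 {b..c}" for y :: "real \<Rightarrow> real ^ 'n"
  proof -
    let ?V = "\<lambda>I t. ennreal (norm (vector_derivative y (at t))) * indicator I t"
    let ?S = "\<lambda>I. SUP t\<in>I. ennreal (norm (y t))"
    \<comment> \<open>The derivative is known to be measurable only through its integrability on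
      \<open>I\<close>; additivity of the nonnegative integral needs this measurability.\<close>
    have meas: "?V I \<in> borel_measurable lebesgue"
      if "(\<lambda>t. vector_derivative y (at t)) absolutely_integrable_on I" for I
    proof -
      have "(\<lambda>t. indicat_real I t *\<^sub>R vector_derivative y (at t)) \<in> borel_measurable lebesgue"
        using that unfolding set_integrable_def by (rule borel_measurable_integrable)
      then have "(\<lambda>t. ennreal (norm (indicat_real I t *\<^sub>R vector_derivative y (at t)))) \<in> borel_measurable lebesgue"
        by measurable
      also have "(\<lambda>t. ennreal (norm (indicat_real I t *\<^sub>R vector_derivative y (at t)))) = ?V I"
        by (auto split: split_indicator)
      finally show ?thesis .
    qed
    have "(\<integral>\<^sup>+ t. ?V {a..c} t \<partial>lebesgue) \<le> (\<integral>\<^sup>+ t. ?V {a..b} t + ?V {b..c} t \<partial>lebesgue)"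
      unfolding un by (intro nn_integral_mono) (auto split: split_indicator)
    also have "\<dots> = (\<integral>\<^sup>+ t. ?V {a..b} t \<partial>lebesgue) + (\<integral>\<^sup>+ t. ?V {b..c} t \<partial>lebesgue)"
      using y by (intro nn_integral_add meas) (auto simp: C11_Icc_iff)
    finally have "(\<integral>\<^sup>+ t. ?V {a..c} t \<partial>lebesgue) \<le>
        (\<integral>\<^sup>+ t. ?V {a..b} t \<partial>lebesgue) + (\<integral>\<^sup>+ t. ?V {b..c} t \<partial>lebesgue)" .
    moreover have "?S {a..c} \<le> ?S {a..b} + ?S {b..c}"
    proof -
      have "?S {a..c} = sup (?S {a..b}) (?S {b..c})" unfolding un by (rule SUP_union)
      also have "\<dots> \<le> ?S {a..b} + ?S {b..c}" by (intro sup_least) auto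
      finally show ?thesis .
    qed
    ultimately have "?S {a..c} + (\<integral>\<^sup>+ t. ?V {a..c} t \<partial>lebesgue) \<le> (?S {a..b} + ?S {b..c}) +
       ((\<integral>\<^sup>+ t. ?V {a..b} t \<partial>lebesgue) + (\<integral>\<^sup>+ t. ?V {b..c} t \<partial>lebesgue))" by (rule add_mono[rotated])
    then show ?thesis unfolding C11_norm_Icc by (simp add: ac_simps)
  qed
  have diff: "(\<lambda>t. y t - x t) \<in> C11 {p..q}" if "y \<in> C11 {p..q}" "x \<in> C11 {p..q}" for p q y
  proof -
    have ae: "AE t in lebesgue. t \<in> {p<..<q} \<longrightarrow> y differentiable (at t) \<and> x differentiable (at t)"
    proof -
      have "AE t in lebesgue. t \<in> {p<..<q} \<longrightarrow> y differentiable (at t)"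
        "AE t in lebesgue. t \<in> {p<..<q} \<longrightarrow> x differentiable (at t)" using that by (auto simp: C11_Icc_iff)
      then show ?thesis by eventually_elim auto
    qed
    \<comment> \<open>Derivative and difference commute only where both functions are
      differentiable; the remaining points are collected in a spike set.\<close>
    obtain N where N: "negligible N" "\<And>t. t \<in> {p<..<q} \<Longrightarrow> t \<notin> N \<Longrightarrow> y differentiable (at t) \<and> x differentiable (at t)"
      using ae unfolding completion.AE_iff_null_sets negligible_iff_null_sets by auto
    have "(\<lambda>t. vector_derivative (\<lambda>t. y t - x t) (at t)) absolutely_integrable_on {p..q}"
    proof (rule absolutely_integrable_spike)
      show "(\<lambda>t. vector_derivative y (at t) - vector_derivative x (at t)) absolutely_integrable_on {p..q}"
        using that by (intro set_integral_diff(1)) (auto simp: C11_Icc_iff)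
      show "negligible (insert p (insert q N))" using N(1) by simp
      show "vector_derivative (\<lambda>t. y t - x t) (at t) = vector_derivative y (at t) - vector_derivative x (at t)"
        if "t \<in> {p..q} - insert p (insert q N)" for t
        using N(2)[of t] that by (intro vector_derivative_diff_at) (auto simp: less_le)
    qed
    then show ?thesis using that ae unfolding C11_Icc_iff
      by (auto intro!: continuous_intros differentiable_diff elim!: eventually_mono)
  qed
  have xC: "x \<in> C11 {a..b}" "x \<in> C11 {b..c}" using 1 2 unfolding C11_tendsto_def by auto
  have ev: "\<forall>\<^sub>F n in sequentially. xs n \<in> C11 {a..b} \<and> xs n \<in> C11 {b..c}"
    using 1 2 unfolding C11_tendsto_def by (auto intro: eventually_conj)
  then have "\<forall>\<^sub>F n in sequentially. C11_norm {a..c} (\<lambda>t. xs n t - x t) \<le>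
      C11_norm {a..b} (\<lambda>t. xs n t - x t) + C11_norm {b..c} (\<lambda>t. xs n t - x t)"
    by eventually_elim (use xC in \<open>auto intro!: le diff\<close>)
  moreover have "(\<lambda>n. C11_norm {a..b} (\<lambda>t. xs n t - x t) + C11_norm {b..c} (\<lambda>t. xs n t - x t)) \<longlonglongrightarrow> 0 + 0"
    using 1 2 unfolding C11_tendsto_def by (intro tendsto_add) auto
  ultimately have "(\<lambda>n. C11_norm {a..c} (\<lambda>t. xs n t - x t)) \<longlonglongrightarrow> 0"
    by (intro tendsto_sandwich[of "\<lambda>_. 0" "\<lambda>n. C11_norm {a..c} (\<lambda>t. xs n t - x t)" sequentially]) auto
  moreover have "\<forall>\<^sub>F n in sequentially. xs n \<in> C11 {a..c}"
    using ev by eventually_elim (use mem in auto)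
  ultimately show ?thesis unfolding C11_tendsto_def using mem xC by auto
qed

text \<open>Here the derivatives within the interval are the right ones: a solution and its initial
  function agree on \<open>{-1..0}\<close> only, and their two-sided derivatives at 0 may
  differ.\<close>

lemma C11_cong_Icc:
  fixes x y :: "real \<Rightarrow> real ^ 'n"
  assumes eq: "\<And>t. t \<in> {a..b} \<Longrightarrow> x t = y t"
  shows "x \<in> C11 {a..b} \<longleftrightarrow> y \<in> C11 {a..b}" and "C11_norm {a..b} x = C11_norm {a..b} y"
proof -
  have hvd: "(x has_vector_derivative v) (at t within {a..b}) \<longleftrightarrow> (y has_vector_derivative v) (at t within {a..b})"
    if "t \<in> {a..b}" for t v
    using has_vector_derivative_transform[OF that, of x y v] has_vector_derivative_transform[OF that, of y x v] eq
    by auto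
  have vd: "vector_derivative x (at t within {a..b}) = vector_derivative y (at t within {a..b})" if "t \<in> {a..b}" for t
    unfolding vector_derivative_def using hvd[OF that] by simp
  have df: "x differentiable (at t within {a..b}) \<longleftrightarrow> y differentiable (at t within {a..b})" if "t \<in> {a..b}" for t
    using hvd[OF that] vector_derivative_works differentiableI_vector by metis
  show "C11_norm {a..b} x = C11_norm {a..b} y"
    unfolding C11_norm_def
    by (intro arg_cong2[of _ _ _ _ "(+)"] SUP_cong nn_integral_cong) (auto simp: eq vd split: split_indicator)
  have "continuous_on {a..b} x \<longleftrightarrow> continuous_on {a..b} y"
    using eq by (intro continuous_on_cong) auto
  moreover have "(\<lambda>t. vector_derivative x (at t within {a..b})) absolutely_integrable_on {a..b} \<longleftrightarrow>
      (\<lambda>t. vector_derivative y (at t within {a..b})) absolutely_integrable_on {a..b}"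
    by (rule set_integrable_cong) (auto simp: vd)
  moreover have "(t \<in> {a..b} \<longrightarrow> x differentiable (at t within {a..b})) \<longleftrightarrow>
      (t \<in> {a..b} \<longrightarrow> y differentiable (at t within {a..b}))" for t using df by blast
  ultimately show "x \<in> C11 {a..b} \<longleftrightarrow> y \<in> C11 {a..b}" unfolding C11_def by simp
qed

lemma C11_tendsto_cong_Icc:
  fixes x y :: "real \<Rightarrow> real ^ 'n"
  assumes "C11_tendsto {a..b} ys y"
    and "\<And>t. t \<in> {a..b} \<Longrightarrow> x t = y t" "\<And>n t. t \<in> {a..b} \<Longrightarrow> xs n t = ys n t"
  shows "C11_tendsto {a..b} xs x"
proof -
  have "C11_norm {a..b} (\<lambda>t. xs n t - x t) = C11_norm {a..b} (\<lambda>t. ys n t - y t)" for n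
    using assms by (intro C11_cong_Icc(2)) auto
  moreover have "xs n \<in> C11 {a..b} \<longleftrightarrow> ys n \<in> C11 {a..b}" for n
    using assms by (intro C11_cong_Icc(1)) auto
  moreover have "x \<in> C11 {a..b} \<longleftrightarrow> y \<in> C11 {a..b}"
    using assms by (intro C11_cong_Icc(1)) auto
  ultimately show ?thesis using assms(1) unfolding C11_tendsto_def by simp
qed

section \<open>Derivatives of solutions\<close>

lemma solution_on_has_vector_derivative_AE:
  assumes x: "solution_on f \<phi> b x" and T: "0 \<le> T" "ereal T < b"
  shows "AE t in lebesgue. t \<in> {0<..<T} \<longrightarrow> (x has_vector_derivative f t (x t, x (t - 1))) (at t)"
proof -
  have "(\<lambda>s. f s (x s, x (s - 1))) integrable_on {0..T}"
    using solution_onD(4)[OF x T] by (auto simp: absolutely_integrable_on_def)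
  from has_vector_derivative_indefinite_integral_AE[OF this] show ?thesis
  proof (eventually_elim, intro impI)
    fix t assume t: "t \<in> {0<..<T}"
      and "t \<in> {0..T} \<longrightarrow> ((\<lambda>u. integral {0..u} (\<lambda>s. f s (x s, x (s - 1)))) has_vector_derivative
        f t (x t, x (t - 1))) (at t within {0..T})"
    then have "((\<lambda>u. \<phi> 0 + integral {0..u} (\<lambda>s. f s (x s, x (s - 1)))) has_vector_derivative
        f t (x t, x (t - 1))) (at t within {0..T})"
      by (auto intro!: derivative_eq_intros)
    then have "(x has_vector_derivative f t (x t, x (t - 1))) (at t within {0..T})"
    proof (rule has_vector_derivative_transform[rotated 2])
      fix u assume "u \<in> {0..T}"
      then show "x u = \<phi> 0 + integral {0..u} (\<lambda>s. f s (x s, x (s - 1)))"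
        using T(2) by (intro solution_onD(5)[OF x]) (auto intro: le_less_trans[of _ "ereal T"])
    qed (use t in auto)
    then show "(x has_vector_derivative f t (x t, x (t - 1))) (at t)"
      using t by (simp add: at_within_Icc_interior)
  qed
qed

lemma solution_on_C11:
  assumes x: "solution_on f \<phi> b x" and T: "0 \<le> T" "ereal T < b"
  shows "x \<in> C11 {0..T}"
proof -
  note ae = solution_on_has_vector_derivative_AE[OF assms]
  obtain N where N: "negligible N"
      "\<And>t. t \<in> {0<..<T} \<Longrightarrow> t \<notin> N \<Longrightarrow> (x has_vector_derivative f t (x t, x (t - 1))) (at t)"
    using ae unfolding completion.AE_iff_null_sets negligible_iff_null_sets by auto
  have "(\<lambda>t. vector_derivative x (at t)) absolutely_integrable_on {0..T}"
    by (rule absolutely_integrable_spike[OF solution_onD(4)[OF assms], of "insert 0 (insert T N)"])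
      (use N in \<open>auto intro!: vector_derivative_at simp: less_le\<close>)
  then show ?thesis
    unfolding C11_Icc_iff using ae continuous_on_subset[OF solution_on_continuous_Icc[OF x T(2)], of "{0..T}"]
    by (auto elim!: eventually_mono intro: differentiableI_vector)
qed

text \<open>Identifies the derivative part of the norm with the integral of the difference of the
  right-hand sides, the quantity which the stability estimate controls.\<close>

lemma C11_norm_solution_diff:
  assumes x: "solution_on f \<phi> b x" and y: "solution_on g \<psi> b' y"
    and T: "0 \<le> T" "ereal T < b" "ereal T < b'"
  shows "C11_norm {0..T} (\<lambda>t. y t - x t) = (SUP t\<in>{0..T}. ennreal (norm (y t - x t))) +
     ennreal (integral {0..T} (\<lambda>s. norm (g s (y s, y (s - 1)) - f s (x s, x (s - 1)))))"
proof -
  let ?D = "\<lambda>s. g s (y s, y (s - 1)) - f s (x s, x (s - 1))"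
  have D: "?D absolutely_integrable_on {0..T}"
    using solution_onD(4)[OF x T(1,2)] solution_onD(4)[OF y T(1,3)] by (rule set_integral_diff(1)[rotated])
  have "AE t in lebesgue. ennreal (norm (vector_derivative (\<lambda>t. y t - x t) (at t))) * indicator {0..T} t =
      ennreal (norm (?D t)) * indicator {0..T} t"
    using solution_on_has_vector_derivative_AE[OF x T(1,2)] solution_on_has_vector_derivative_AE[OF y T(1,3)]
      AE_lebesgue_neq[of 0] AE_lebesgue_neq[of T]
  proof eventually_elim
    case (elim t)
    show ?case
    proof (cases "t \<in> {0..T}")
      case True
      then have "t \<in> {0<..<T}" using elim by auto
      then have "vector_derivative (\<lambda>t. y t - x t) (at t) = ?D t"
        using elim by (intro vector_derivative_at has_vector_derivative_diff) auto
      then show ?thesis by simp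
    qed simp
  qed
  then have "(\<integral>\<^sup>+ t\<in>{0..T}. ennreal (norm (vector_derivative (\<lambda>t. y t - x t) (at t))) \<partial>lebesgue) =
      (\<integral>\<^sup>+ t\<in>{0..T}. ennreal (norm (?D t)) \<partial>lebesgue)"
    by (rule nn_integral_cong_AE)
  then show ?thesis unfolding C11_norm_Icc nn_integral_norm_absolutely_integrable[OF D] by simp
qed

section \<open>Convergence of the vector fields along solutions\<close>

lemma finite_net_of_dense:
  fixes S :: "'a::metric_space set"
  assumes "compact S" "closure D = UNIV" "\<eta> > 0"
  obtains U where "finite U" "U \<subseteq> D" "\<And>z. z \<in> S \<Longrightarrow> \<exists>u\<in>U. dist z u < \<eta>"
proof -
  have "S \<subseteq> (\<Union>u\<in>D. ball u \<eta>)"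
  proof
    fix z assume "z \<in> S"
    have "z \<in> closure D" using assms(2) by simp
    then obtain u where "u \<in> D" "dist u z < \<eta>" using assms(3) closure_approachable by blast
    then show "z \<in> (\<Union>u\<in>D. ball u \<eta>)" by auto
  qed
  then obtain U where "U \<subseteq> D" "finite U" "S \<subseteq> (\<Union>u\<in>U. ball u \<eta>)"
    using compactE_image[OF assms(1), of D "\<lambda>u. ball u \<eta>"] by auto
  then show thesis by (intro that[of U]) (auto simp: dist_commute dest!: subsetD)
qed

text \<open>The carrier of the topology is the union of its generating sets, all contained in
  \<open>LC\<close>; hence a limit lies in \<open>LC\<close>. Vanishing of \<open>p\<close> at the
  zero field puts \<open>f\<close> into the generating set centred at \<open>f\<close>.\<close>

lemma limitin_LC_topology:
  assumes "limitin (LC_topology P) fs f sequentially"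
  shows "f \<in> LC"
    and "\<And>p \<epsilon>. p \<in> P \<Longrightarrow> p (\<lambda>t z. 0) = 0 \<Longrightarrow> \<epsilon> > 0 \<Longrightarrow>
      \<forall>\<^sub>F n in sequentially. p (\<lambda>t z. fs n t z - f t z) < ennreal \<epsilon>"
proof -
  let ?B = "{{g \<in> LC. p (\<lambda>t z. g t z - f t z) < ennreal \<epsilon>} | p f \<epsilon>. p \<in> P \<and> f \<in> LC \<and> \<epsilon> > 0}"
  have "f \<in> \<Union>?B"
    using assms unfolding limitin_def LC_topology_def topology_generated_by_topspace by blast
  then show f: "f \<in> LC" by blast
  fix p \<epsilon> assume p: "p \<in> P" "p (\<lambda>t z. 0) = 0" and \<epsilon>: "(\<epsilon>::real) > 0"
  let ?V = "{g \<in> LC. p (\<lambda>t z. g t z - f t z) < ennreal \<epsilon>}"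
  have "openin (LC_topology P) ?V"
    unfolding LC_topology_def using p \<epsilon> f by (intro topology_generated_by_Basis) blast
  moreover have "f \<in> ?V" using f p \<epsilon> by simp
  ultimately have "\<forall>\<^sub>F n in sequentially. fs n \<in> ?V"
    using assms unfolding limitin_def by blast
  then show "\<forall>\<^sub>F n in sequentially. p (\<lambda>t z. fs n t z - f t z) < ennreal \<epsilon>"
    by eventually_elim simp
qed

lemma integral_norm_le_nn_integral_bound:
  fixes q :: "'a::euclidean_space \<Rightarrow> 'b::euclidean_space"
  assumes q: "q \<in> borel_measurable lebesgue" and S: "S \<in> sets lebesgue" "S \<subseteq> S'"
    and le: "(\<integral>\<^sup>+ t\<in>S'. ennreal (norm (q t)) \<partial>lebesgue) \<le> ennreal \<delta>" and "0 \<le> \<delta>"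
  shows "q absolutely_integrable_on S" and "integral S (\<lambda>t. norm (q t)) \<le> \<delta>"
proof -
  have "(\<integral>\<^sup>+ t\<in>S. ennreal (norm (q t)) \<partial>lebesgue) \<le> (\<integral>\<^sup>+ t\<in>S'. ennreal (norm (q t)) \<partial>lebesgue)"
    using S(2) by (intro nn_integral_mono) (auto split: split_indicator)
  with le have le': "(\<integral>\<^sup>+ t\<in>S. ennreal (norm (q t)) \<partial>lebesgue) \<le> ennreal \<delta>" by (rule order_trans[rotated])
  show ai: "q absolutely_integrable_on S"
    using le' by (intro absolutely_integrable_nn_integral_finite q S) (simp add: le_less_trans)
  show "integral S (\<lambda>t. norm (q t)) \<le> \<delta>"
    using le' \<open>0 \<le> \<delta>\<close> unfolding nn_integral_norm_absolutely_integrable[OF ai] by simp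
qed

lemma uniform_bound_on_subinterval:
  fixes B :: "'c \<Rightarrow> real \<Rightarrow> ennreal"
  assumes "\<And>r. r > 0 \<Longrightarrow> (SUP f\<in>E. \<integral>\<^sup>+ t\<in>{-r..r}. B f t \<partial>lebesgue) < \<infinity>" and "0 \<le> T"
  obtains C where "0 \<le> C" "\<And>f. f \<in> E \<Longrightarrow> (\<integral>\<^sup>+ t\<in>{0..T}. B f t \<partial>lebesgue) \<le> ennreal C"
proof -
  \<comment> \<open>The radius \<open>T + 1\<close> is positive also for
    \<open>T = 0\<close>.\<close>
  let ?S = "SUP f\<in>E. \<integral>\<^sup>+ t\<in>{-(T+1)..T+1}. B f t \<partial>lebesgue"
  have fin: "?S < \<infinity>" by (rule assms(1)) (use assms(2) in simp)
  show thesis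
  proof (rule that[of "enn2real ?S"])
    fix f assume "f \<in> E"
    then have "(\<integral>\<^sup>+ t\<in>{-(T+1)..T+1}. B f t \<partial>lebesgue) \<le> ?S" by (rule SUP_upper)
    moreover have "(\<integral>\<^sup>+ t\<in>{0..T}. B f t \<partial>lebesgue) \<le> (\<integral>\<^sup>+ t\<in>{-(T+1)..T+1}. B f t \<partial>lebesgue)"
      using assms(2) by (intro nn_integral_mono) (auto split: split_indicator)
    ultimately show "(\<integral>\<^sup>+ t\<in>{0..T}. B f t \<partial>lebesgue) \<le> ennreal (enn2real ?S)" using fin by simp
  qed simp
qed

text \<open>\<open>[-r, r]\<close> is a chain of \<open>N\<close> intervals shorter than the
  \<delta> belonging to \<epsilon> = 1, and \<open>N\<close> is the same for all members of
  \<open>E\<close>.\<close>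

lemma equicontinuous_m_bounds_finite:
  assumes E: "E \<subseteq> LC" and eq: "L1_loc_equicontinuous_m_bounds E" and r: "r > 0"
  shows "(SUP f\<in>E. \<integral>\<^sup>+ t\<in>{-r..r}. m_bound j f t \<partial>lebesgue) < \<infinity>"
proof -
  obtain \<delta> where \<delta>: "\<delta> > 0" and small: "\<And>s t. - r \<le> s \<Longrightarrow> s \<le> t \<Longrightarrow> t \<le> r \<Longrightarrow> t - s < \<delta> \<Longrightarrow>
        (SUP f\<in>E. \<integral>\<^sup>+ u\<in>{s..t}. m_bound j f u \<partial>lebesgue) < ennreal 1"
    using eq[unfolded L1_loc_equicontinuous_m_bounds_def, rule_format, OF r zero_less_one, of j] by blast
  obtain N :: nat where N: "2 * r / \<delta> < real N" using reals_Archimedean2 by blast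
  then have N0: "0 < real N" using r \<delta> by (smt (verit) divide_pos_pos)
  define w where "w = 2 * r / real N"
  have w: "0 < w" "w < \<delta>" using N N0 r \<delta> unfolding w_def by (auto simp: field_simps)
  have wN: "- r + real N * w = r" using N0 unfolding w_def by simp
  have "(\<integral>\<^sup>+ t\<in>{-r..-r + real i * w}. m_bound j f t \<partial>lebesgue) \<le> ennreal (real i)"
    if f: "f \<in> E" and "i \<le> N" for f i
    using \<open>i \<le> N\<close>
  proof (induction i)
    case 0
    have "AE t in lebesgue. m_bound j f t * indicator {-r..-r} t = 0"
      using AE_lebesgue_neq[of "-r"] by eventually_elim (auto split: split_indicator)
    then show ?case by (simp add: nn_integral_cong_AE[of _ "\<lambda>_. 0"])
  next
    case (Suc i)
    let ?a = "-r + real i * w" and ?b = "-r + real (Suc i) * w"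
    have ab: "-r \<le> ?a" "?a \<le> ?b" "?b - ?a < \<delta>" using w by (auto simp: algebra_simps)
    have "real (Suc i) * w \<le> real N * w" using Suc w by (intro mult_right_mono) auto
    then have "?b \<le> r" using wN by linarith
    then have "(SUP f\<in>E. \<integral>\<^sup>+ u\<in>{?a..?b}. m_bound j f u \<partial>lebesgue) < ennreal 1"
      using small[OF ab(1,2) _ ab(3)] by blast
    then have 1: "(\<integral>\<^sup>+ u\<in>{?a..?b}. m_bound j f u \<partial>lebesgue) \<le> ennreal 1"
      by (rule order_trans[OF SUP_upper[OF f] less_imp_le])
    have mb: "m_bound j f \<in> borel_measurable lebesgue"
      using f E by (intro m_bound_measurable) auto
    have "(\<integral>\<^sup>+ t\<in>{-r..?b}. m_bound j f t \<partial>lebesgue) \<le>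
       (\<integral>\<^sup>+ t. m_bound j f t * indicator {-r..?a} t + m_bound j f t * indicator {?a..?b} t \<partial>lebesgue)"
      by (intro nn_integral_mono) (auto split: split_indicator)
    also have "\<dots> = (\<integral>\<^sup>+ t\<in>{-r..?a}. m_bound j f t \<partial>lebesgue) + (\<integral>\<^sup>+ u\<in>{?a..?b}. m_bound j f u \<partial>lebesgue)"
      by (intro nn_integral_add borel_measurable_times_ennreal borel_measurable_indicator mb) auto
    also have "\<dots> \<le> ennreal (real i) + ennreal 1" using Suc 1 by (intro add_mono) auto
    also have "\<dots> = ennreal (real (Suc i))"
      using ennreal_plus[of "real i" 1] by (simp add: add.commute)
    finally show ?case .
  qed
  from this[of _ N] have "(SUP f\<in>E. \<integral>\<^sup>+ t\<in>{-r..r}. m_bound j f t \<partial>lebesgue) \<le> ennreal (real N)"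
    unfolding wN by (intro SUP_least) auto
  then show ?thesis by (simp add: le_less_trans)
qed

text \<open>Finiteness of the supremum matters: otherwise the real-valued modulus would be zero.\<close>

lemma m_bound_le_m_moduli:
  assumes E: "E \<subseteq> LC" and eq: "L1_loc_equicontinuous_m_bounds E" and f: "f \<in> E"
    and t: "of_rat q1 \<le> t" "t \<le> of_rat q2" and s: "0 \<le> s" "s \<le> of_rat q2 - of_rat q1"
    and c: "ennreal c \<le> (\<integral>\<^sup>+ u\<in>{t..t + s}. m_bound j f u \<partial>lebesgue)"
  shows "c \<le> m_moduli E j q1 q2 s"
proof -
  let ?S = "SUP t \<in> {of_rat q1..of_rat q2}. SUP f\<in>E. \<integral>\<^sup>+ u\<in>{t..t + s}. m_bound j f u \<partial>lebesgue"
  \<comment> \<open>With \<open>t\<close> in the interval and \<open>s\<close> at most its length,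
    \<open>t + s\<close> is at most \<open>2 * of_rat q2 - of_rat q1\<close>; one radius covers all
    integration intervals.\<close>
  define r where "r = \<bar>of_rat q1\<bar> + 2 * \<bar>of_rat q2\<bar> + \<bar>of_rat q1\<bar> + (1 :: real)"
  have "?S \<le> (SUP f\<in>E. \<integral>\<^sup>+ u\<in>{-r..r}. m_bound j f u \<partial>lebesgue)"
  proof (rule SUP_least)
    fix t :: real assume "t \<in> {of_rat q1..of_rat q2}"
    then have "of_rat q1 \<le> t" "t \<le> of_rat q2" by auto
    then have "-r \<le> t" "t + s \<le> r" using s unfolding r_def by linarith+
    then have "{t..t + s} \<subseteq> {-r..r}" by auto
    then show "(SUP f\<in>E. \<integral>\<^sup>+ u\<in>{t..t + s}. m_bound j f u \<partial>lebesgue) \<le>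
        (SUP f\<in>E. \<integral>\<^sup>+ u\<in>{-r..r}. m_bound j f u \<partial>lebesgue)"
      by (intro SUP_mono' nn_integral_mono) (auto split: split_indicator)
  qed
  also have "\<dots> < \<infinity>" by (rule equicontinuous_m_bounds_finite[OF E eq]) (use r_def in linarith)
  finally have fin: "?S < \<infinity>" .
  have "ennreal c \<le> (SUP f\<in>E. \<integral>\<^sup>+ u\<in>{t..t + s}. m_bound j f u \<partial>lebesgue)"
    using c f by (rule order_trans[OF _ SUP_upper])
  also have "\<dots> \<le> ?S" using t by (intro SUP_upper) auto
  finally have "ennreal c \<le> ennreal (enn2real ?S)" using fin by simp
  then show ?thesis unfolding m_moduli_def by (simp only: ennreal_le_iff[OF enn2real_nonneg])
qed

lemma solutions_C11_tendsto:
  fixes x :: "real \<Rightarrow> real ^ 'n"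
  assumes sol: "\<And>n. solution_on (fs n) (\<phi>s n) (bs n) (xs n)" and x: "solution_on f \<phi> b x"
    and T: "0 \<le> T" "ereal T < b"
    and stab: "\<And>e. e > 0 \<Longrightarrow> \<forall>\<^sub>F n in sequentially. ereal T < bs n \<and>
      (\<forall>s\<in>{-1..T}. norm (xs n s - x s) \<le> e) \<and>
      integral {0..T} (\<lambda>s. norm (fs n s (xs n s, xs n (s - 1)) - f s (x s, x (s - 1)))) \<le> e"
  shows "(\<forall>\<^sub>F n in sequentially. ereal T < bs n) \<and> uniform_limit {-1..T} xs x sequentially \<and>
    C11_tendsto {0..T} xs x"
proof (intro conjI)
  show Tb: "\<forall>\<^sub>F n in sequentially. ereal T < bs n"
    using stab[of 1] by (auto elim: eventually_mono)
  show "uniform_limit {-1..T} xs x sequentially"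
  proof (rule uniform_limitI)
    fix e :: real assume "e > 0"
    then show "\<forall>\<^sub>F n in sequentially. \<forall>s\<in>{-1..T}. dist (xs n s) (x s) < e"
      using stab[of "e / 2"] by (force elim!: eventually_mono simp: dist_norm)
  qed
  show "C11_tendsto {0..T} xs x"
    unfolding C11_tendsto_def
  proof (intro conjI)
    show "x \<in> C11 {0..T}" by (rule solution_on_C11[OF x T])
    show "\<forall>\<^sub>F n in sequentially. xs n \<in> C11 {0..T}"
      using Tb by eventually_elim (rule solution_on_C11[OF sol T(1)])
    show "(\<lambda>n. C11_norm {0..T} (\<lambda>t. xs n t - x t)) \<longlonglongrightarrow> 0"
    proof (rule tendsto_zero_ennreal)
      fix r :: real assume r: "0 < r"
      then have "0 < r / 3" by simp
      from stab[OF this] show "\<forall>\<^sub>F n in sequentially. C11_norm {0..T} (\<lambda>t. xs n t - x t) < ennreal r"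
      proof eventually_elim
        case (elim n)
        have "C11_norm {0..T} (\<lambda>t. xs n t - x t) \<le> ennreal (r / 3) + ennreal (r / 3)"
          unfolding C11_norm_solution_diff[OF x sol T conjunct1[OF elim]]
          using elim by (intro add_mono SUP_least ennreal_leI) auto
        also have "\<dots> = ennreal (2 * r / 3)" using r by (subst ennreal_plus[symmetric]) auto
        also have "\<dots> < ennreal r" using r by (intro ennreal_lessI) auto
        finally show ?case .
      qed
    qed
  qed
qed

section \<open>Defects from a finite net\<close>

lemma norm_solution_pair_bound:
  fixes x :: "real \<Rightarrow> 'a::real_normed_vector"
  assumes R: "\<And>s. s \<in> {-1..T} \<Longrightarrow> norm (x s) \<le> R" and s: "s \<in> {0..T}"
  shows "norm (x s, x (s - 1)) \<le> 2 * R"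
  using norm_Pair_le[of "x s" "x (s - 1)"] R[of s] R[of "s - 1"] s by auto

text \<open>In \<open>h\<close> the term \<open>k s * \<eta>\<close> pays for moving to a net point
  and back, the sum for f_n - f at the net points. Summing over all of \<open>U\<close> replaces a
  choice of the nearest point, which would depend on \<open>s\<close>. The integrals of
  \<open>q\<close> run to \<open>Q\<close>, later the rational endpoint of a seminorm
  interval.\<close>

lemma defect_kernel_integrals:
  fixes q :: "'c \<Rightarrow> real \<Rightarrow> 'b::euclidean_space"
  assumes T: "0 \<le> T" "T \<le> Q" "\<tau> \<le> T"
    and k: "k absolutely_integrable_on {0..T}" "\<And>s. 0 \<le> k s" "integral {0..T} k \<le> C"
    and U: "finite U" and \<eta>: "0 \<le> \<eta>" and \<delta>: "0 \<le> \<delta>"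
    and q: "\<And>u. u \<in> U \<Longrightarrow> q u \<in> borel_measurable lebesgue"
      "\<And>u. u \<in> U \<Longrightarrow> (\<integral>\<^sup>+ t\<in>{0..Q}. ennreal (norm (q u t)) \<partial>lebesgue) \<le> ennreal \<delta>"
  defines "h \<equiv> \<lambda>s. k s * \<eta> + (\<Sum>u\<in>U. norm (q u s))"
  shows "k absolutely_integrable_on {0..\<tau>}" "integral {0..\<tau>} k \<le> C"
    "h absolutely_integrable_on {0..\<tau>}" "\<And>s. 0 \<le> h s" "integral {0..\<tau>} h \<le> C * \<eta> + real (card U) * \<delta>"
proof -
  show ki: "k absolutely_integrable_on {0..\<tau>}"
    using k(1) T by (auto intro: absolutely_integrable_on_subinterval)
  have "integral {0..\<tau>} k \<le> integral {0..T} k"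
    using ki k T by (intro integral_subset_le) (auto simp: absolutely_integrable_on_def)
  then show kC: "integral {0..\<tau>} k \<le> C" using k(3) by linarith
  have qi: "(\<lambda>s. norm (q u s)) absolutely_integrable_on {0..\<tau>}" "integral {0..\<tau>} (\<lambda>s. norm (q u s)) \<le> \<delta>"
    if "u \<in> U" for u
  proof -
    have sub: "{0..\<tau>} \<subseteq> {0..Q}" using T by auto
    note I = integral_norm_le_nn_integral_bound[OF q(1)[OF that] _ sub q(2)[OF that] \<delta>]
    show "(\<lambda>s. norm (q u s)) absolutely_integrable_on {0..\<tau>}" "integral {0..\<tau>} (\<lambda>s. norm (q u s)) \<le> \<delta>"
      using I by (auto intro: set_integrable_norm)
  qed
  have ke: "(\<lambda>s. k s * \<eta>) absolutely_integrable_on {0..\<tau>}"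
    using ki by (intro set_integrable_mult_left) auto
  have Si: "(\<lambda>s. \<Sum>u\<in>U. norm (q u s)) absolutely_integrable_on {0..\<tau>}"
    using U qi by (intro absolutely_integrable_sum) auto
  show "h absolutely_integrable_on {0..\<tau>}"
    unfolding h_def using ke Si by (rule set_integral_add(1))
  show "0 \<le> h s" for s unfolding h_def
    by (intro add_nonneg_nonneg mult_nonneg_nonneg sum_nonneg) (use k(2) \<eta> in auto)
  have "integral {0..\<tau>} h = integral {0..\<tau>} k * \<eta> + (\<Sum>u\<in>U. integral {0..\<tau>} (\<lambda>s. norm (q u s)))"
    unfolding h_def using ke Si qi U
    by (subst Henstock_Kurzweil_Integration.integral_add)
      (auto simp: absolutely_integrable_on_def Henstock_Kurzweil_Integration.integral_sum)
  also have "\<dots> \<le> C * \<eta> + (\<Sum>u\<in>U. \<delta>)"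
    using kC \<eta> qi by (intro add_mono mult_right_mono sum_mono) auto
  finally show "integral {0..\<tau>} h \<le> C * \<eta> + real (card U) * \<delta>" by simp
qed

text \<open>\<open>q\<close> may depend on \<tau>, because in (i) the curve along which f_n - f is
  tested is x_n stopped at \<tau>; the bound \<delta> is nevertheless uniform in \<tau>.\<close>

lemma defect_boundI:
  fixes q :: "real \<Rightarrow> 'c \<Rightarrow> real \<Rightarrow> 'b::euclidean_space"
  assumes T: "0 \<le> T" "T \<le> Q"
    and k: "k absolutely_integrable_on {0..T}" "\<And>s. 0 \<le> k s" "integral {0..T} k \<le> C"
    and U: "finite U" and \<eta>: "0 \<le> \<eta>" and \<delta>: "0 \<le> \<delta>" and \<epsilon>: "C * \<eta> + real (card U) * \<delta> \<le> \<epsilon>"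
    and q: "\<And>\<tau> u. u \<in> U \<Longrightarrow> q \<tau> u \<in> borel_measurable lebesgue"
    and qle: "\<And>\<tau> u. \<lbrakk>0 \<le> \<tau>; \<tau> \<le> T; ereal \<tau> < b; \<forall>s\<in>{-1..\<tau>}. norm (y s - x s) \<le> 1; u \<in> U\<rbrakk> \<Longrightarrow>
      (\<integral>\<^sup>+ t\<in>{0..Q}. ennreal (norm (q \<tau> u t)) \<partial>lebesgue) \<le> ennreal \<delta>"
    and ae: "\<And>\<tau>. \<lbrakk>0 \<le> \<tau>; \<tau> \<le> T; ereal \<tau> < b; \<forall>s\<in>{-1..\<tau>}. norm (y s - x s) \<le> 1\<rbrakk> \<Longrightarrow>
      AE s in lebesgue. s \<in> {0..\<tau>} \<longrightarrow>
        norm (g s (y s, y (s - 1)) - f s (x s, x (s - 1)))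
          \<le> k s * (norm (y s - x s) + norm (y (s - 1) - x (s - 1))) + (k s * \<eta> + (\<Sum>u\<in>U. norm (q \<tau> u s)))"
  shows "defect_bound T C \<epsilon> f x g y b"
  unfolding defect_bound_def
proof (intro allI impI)
  fix \<tau> assume \<tau>: "0 \<le> \<tau>" "\<tau> \<le> T" "ereal \<tau> < b" "\<forall>s\<in>{-1..\<tau>}. norm (y s - x s) \<le> 1"
  let ?h = "\<lambda>s. k s * \<eta> + (\<Sum>u\<in>U. norm (q \<tau> u s))"
  note K = defect_kernel_integrals[where q = "q \<tau>", OF T \<tau>(2) k U \<eta> \<delta> q qle[OF \<tau>]]
  show "\<exists>k h. k absolutely_integrable_on {0..\<tau>} \<and> h absolutely_integrable_on {0..\<tau>} \<and>
          (\<forall>s. 0 \<le> k s) \<and> (\<forall>s. 0 \<le> h s) \<and> integral {0..\<tau>} k \<le> C \<and> integral {0..\<tau>} h \<le> \<epsilon> \<and>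
          (AE s in lebesgue. s \<in> {0..\<tau>} \<longrightarrow>
             norm (g s (y s, y (s - 1)) - f s (x s, x (s - 1)))
               \<le> k s * (norm (y s - x s) + norm (y (s - 1) - x (s - 1))) + h s)"
  proof (rule exI[of _ k], rule exI[of _ ?h], intro conjI allI)
    show "integral {0..\<tau>} ?h \<le> \<epsilon>" using K(5) \<epsilon> by simp
  qed (use K ae[OF \<tau>] k(2) in auto)
qed

text \<open>The condition \<eta> \<le> 1 keeps the net points in the ball on which the kernels are
  valid; dividing by \<open>C + 1\<close> covers \<open>C = 0\<close>.\<close>

lemma exists_net_parameters:
  fixes \<epsilon> C :: real
  assumes "\<epsilon> > 0" "0 \<le> C"
  obtains \<eta> where "0 < \<eta>" "\<eta> \<le> 1" "C * \<eta> \<le> \<epsilon> / 2"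
proof
  show "0 < min 1 (\<epsilon> / (2 * (C + 1)))" "min 1 (\<epsilon> / (2 * (C + 1))) \<le> 1" using assms by auto
  have "C * min 1 (\<epsilon> / (2 * (C + 1))) \<le> (C + 1) * (\<epsilon> / (2 * (C + 1)))"
    using assms by (intro mult_mono) auto
  also have "\<dots> = \<epsilon> / 2" using assms by (simp add: field_simps)
  finally show "C * min 1 (\<epsilon> / (2 * (C + 1))) \<le> \<epsilon> / 2" .
qed

section \<open>Convergence at the points of a dense set, case (ii)\<close>

text \<open>\<open>C\<close> is fixed before \<epsilon>, because the Gronwall factor depends on it
  and the tolerance is chosen according to that factor. The net, \<eta> and \<delta> depend on
  \<epsilon>; as the net is finite, convergence in finitely many seminorms suffices.\<close>

lemma l_bounds_imp_defect_bound:
  fixes E :: "(real \<Rightarrow> (real ^ 'n) \<times> (real ^ 'n) \<Rightarrow> real ^ 'n) set"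
  assumes E: "E \<subseteq> LC" "\<And>n. fs n \<in> E" and D: "closure D = UNIV"
    and bdd: "L1_loc_bounded_l_bounds E" and lim: "limitin (T_D D) fs f sequentially"
    and x: "solution_on f \<phi> b x" and T: "0 \<le> T" "ereal T < b"
  obtains C where "\<And>\<epsilon>. \<epsilon> > 0 \<Longrightarrow> \<forall>\<^sub>F n in sequentially. defect_bound T C \<epsilon> f x (fs n) (xs n) (bs n)"
proof -
  note f = limitin_LC_topology(1)[OF lim[unfolded T_D_def]]
  have fsLC: "fs n \<in> LC" for n using E by auto
  have cx: "continuous_on {-1..T} x" by (rule solution_on_continuous_Icc[OF x T(2)])
  then have "bounded (x ` {-1..T})" by (intro compact_imp_bounded compact_continuous_image) auto
  then obtain R where "\<forall>y\<in>x ` {-1..T}. norm y \<le> R" unfolding bounded_iff ..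
  then have R: "norm (x s) \<le> R" if "s \<in> {-1..T}" for s using that by blast
  \<comment> \<open>A pair of points of norm at most \<open>R + 1\<close> has norm at most
    \<open>2 * (R + 1)\<close>; this ball contains the pairs of values of x_n in the unit
    tube.\<close>
  obtain j :: nat where j: "2 * (R + 1) \<le> real j" using real_arch_simple by blast
  obtain m l where "\<And>a b. m absolutely_integrable_on {a..b}"
      and l: "\<And>a b. l absolutely_integrable_on {a..b}" and "\<And>t. 0 \<le> m t" and l0: "\<And>t. 0 \<le> l t"
      and lae: "AE t in lebesgue. (\<forall>z\<in>cball 0 (real j). norm (f t z) \<le> m t) \<and>
        (\<forall>z1\<in>cball 0 (real j). \<forall>z2\<in>cball 0 (real j). norm (f t z1 - f t z2) \<le> l t * norm (z1 - z2))"
    by (rule LC_bounds[OF f compact_cball[of 0 "real j"]]) (rule that)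
  obtain C0 where C0: "0 \<le> C0" "\<And>g. g \<in> E \<Longrightarrow> (\<integral>\<^sup>+ t\<in>{0..T}. l_bound j g t \<partial>lebesgue) \<le> ennreal C0"
    by (rule uniform_bound_on_subinterval[OF bdd[unfolded L1_loc_bounded_l_bounds_def, rule_format, of _ j] T(1)])
      (auto intro: that)
  define C where "C = C0 + integral {0..T} l"
  have "0 \<le> integral {0..T} l"
    using l l0 by (intro Henstock_Kurzweil_Integration.integral_nonneg) (auto simp: absolutely_integrable_on_def)
  then have C: "0 \<le> C" using C0 unfolding C_def by simp
  define v where "v = (\<lambda>s. (x s, x (s - 1)))"
  have v: "norm (v s) \<le> 2 * R" if "s \<in> {0..T}" for s
    unfolding v_def by (rule norm_solution_pair_bound[OF R that])
  have "continuous_on {0..T} v"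
    unfolding v_def
    by (intro continuous_on_Pair continuous_on_subset[OF cx] continuous_on_compose2[OF cx] continuous_intros) auto
  then have cv: "compact (v ` {0..T})" by (intro compact_continuous_image) auto
  show thesis
  proof (rule that[of C])
    fix \<epsilon> :: real assume \<epsilon>: "\<epsilon> > 0"
    obtain \<eta> where \<eta>: "0 < \<eta>" "\<eta> \<le> 1" "C * \<eta> \<le> \<epsilon> / 2" by (rule exists_net_parameters[OF \<epsilon> C])
    obtain U where U: "finite U" "U \<subseteq> D" "\<And>z. z \<in> v ` {0..T} \<Longrightarrow> \<exists>u\<in>U. dist z u < \<eta>"
      by (rule finite_net_of_dense[OF cv D \<eta>(1)]) (rule that)
    define \<delta> where "\<delta> = \<epsilon> / (2 * (real (card U) + 1))"
    have \<delta>: "0 < \<delta>" "real (card U) * \<delta> \<le> \<epsilon> / 2"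
      using \<epsilon> unfolding \<delta>_def by (auto simp: field_simps add_pos_nonneg)
    \<comment> \<open>Only intervals with rational endpoints carry seminorms, so \<open>T\<close> is
      rounded up.\<close>
    define q2 where "q2 = (of_nat (nat \<lceil>T\<rceil>) :: rat)"
    have q2: "T \<le> of_rat q2" "0 \<le> q2" unfolding q2_def by (auto simp: real_nat_ceiling_ge)
    have "\<forall>\<^sub>F n in sequentially. seminorm_D 0 q2 u (\<lambda>t z. fs n t z - f t z) < ennreal \<delta>" if "u \<in> U" for u
    proof (rule limitin_LC_topology(2)[OF lim[unfolded T_D_def] _ _ \<delta>(1)])
      show "seminorm_D 0 q2 u \<in> {seminorm_D q1 q2 z |q1 q2 z. q1 \<le> q2 \<and> z \<in> D}"
        using that U(2) q2 by blast
    qed (simp add: seminorm_D_def)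
    then have "\<forall>\<^sub>F n in sequentially. \<forall>u\<in>U. seminorm_D 0 q2 u (\<lambda>t z. fs n t z - f t z) < ennreal \<delta>"
      by (intro eventually_ball_finite U) auto
    then show "\<forall>\<^sub>F n in sequentially. defect_bound T C \<epsilon> f x (fs n) (xs n) (bs n)"
    proof eventually_elim
      case (elim n)
      obtain kn where kn: "kn absolutely_integrable_on {0..T}" "\<And>t. 0 \<le> kn t" "integral {0..T} kn \<le> C0"
        and kae: "AE t in lebesgue. t \<in> {0..T} \<longrightarrow> (\<forall>z1\<in>cball 0 (real j). \<forall>z2\<in>cball 0 (real j).
            norm (fs n t z1 - fs n t z2) \<le> kn t * norm (z1 - z2))"
        by (rule l_bound_kernel[OF fsLC _ C0(2)[OF E(2)] C0(1)]) (auto intro: that)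
      \<comment> \<open>One function serves as Gronwall kernel and as coefficient of \<eta>. The
        summand \<open>l\<close> pays for the way of \<open>f\<close> from the net point back to the
        curve.\<close>
      define k where "k = (\<lambda>t. kn t + l t)"
      have k: "k absolutely_integrable_on {0..T}" "\<And>s. 0 \<le> k s"
        unfolding k_def using kn l l0 by (auto intro: set_integral_add(1))
      have "integral {0..T} k = integral {0..T} kn + integral {0..T} l"
        unfolding k_def using kn(1) l[of 0 T]
        by (intro Henstock_Kurzweil_Integration.integral_add) (auto simp: absolutely_integrable_on_def)
      then have kC: "integral {0..T} k \<le> C" using kn(3) unfolding C_def by simp
      define q where "q = (\<lambda>u t. fs n t u - f t u)"
      have q: "q u \<in> borel_measurable lebesgue" if "u \<in> U" for u
        unfolding q_def using f fsLC[of n] by (intro borel_measurable_diff LC_compose_lebesgue) auto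
      have qle: "(\<integral>\<^sup>+ t\<in>{0..of_rat q2}. ennreal (norm (q u t)) \<partial>lebesgue) \<le> ennreal \<delta>" if "u \<in> U" for u
        using elim that unfolding seminorm_D_def q_def by (auto simp: less_imp_le)
      show ?case
      proof (rule defect_boundI[where q = "\<lambda>_. q", OF T(1) q2(1) k kC U(1) less_imp_le[OF \<eta>(1)] less_imp_le[OF \<delta>(1)] _ q qle])
        show "C * \<eta> + real (card U) * \<delta> \<le> \<epsilon>" using \<eta>(3) \<delta>(2) by linarith
        fix \<tau> assume \<tau>: "0 \<le> \<tau>" "\<tau> \<le> T" "ereal \<tau> < bs n" and d1: "\<forall>s\<in>{-1..\<tau>}. norm (xs n s - x s) \<le> 1"
        let ?h = "\<lambda>s. k s * \<eta> + (\<Sum>u\<in>U. norm (q u s))"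
        show "AE s in lebesgue. s \<in> {0..\<tau>} \<longrightarrow>
             norm (fs n s (xs n s, xs n (s - 1)) - f s (x s, x (s - 1)))
               \<le> k s * (norm (xs n s - x s) + norm (xs n (s - 1) - x (s - 1))) + ?h s"
          using lae kae
        proof (eventually_elim, intro impI)
          fix s assume s: "s \<in> {0..\<tau>}"
            and ls: "(\<forall>z\<in>cball 0 (real j). norm (f s z) \<le> m s) \<and>
              (\<forall>z1\<in>cball 0 (real j). \<forall>z2\<in>cball 0 (real j). norm (f s z1 - f s z2) \<le> l s * norm (z1 - z2))"
            and ks: "s \<in> {0..T} \<longrightarrow> (\<forall>z1\<in>cball 0 (real j). \<forall>z2\<in>cball 0 (real j).
              norm (fs n s z1 - fs n s z2) \<le> kn s * norm (z1 - z2))"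
          let ?z = "(xs n s, xs n (s - 1))"
          let ?d = "norm (xs n s - x s) + norm (xs n (s - 1) - x (s - 1))"
          have sT: "s \<in> {0..T}" using s \<tau> by auto
          obtain u where u: "u \<in> U" "dist (v s) u < \<eta>" using U(3) sT by blast
          have "norm (xs n r) \<le> R + 1" if "r \<in> {-1..\<tau>}" for r
            using norm_triangle_ineq[of "x r" "xs n r - x r"] d1 R[of r] that \<tau> by force
          then have "norm ?z \<le> 2 * (R + 1)" using s \<tau> by (intro norm_solution_pair_bound) auto
          then have zj: "?z \<in> cball 0 (real j)" using j by simp
          have vj: "v s \<in> cball 0 (real j)" using v[OF sT] j by simp
          have uj: "u \<in> cball 0 (real j)"
            using norm_triangle_ineq2[of u "v s"] v[OF sT] j u(2) \<eta>(2) by (simp add: dist_norm norm_minus_commute)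
          \<comment> \<open>Four moves: \<open>fs n\<close> from the pair of x_n to the curve
            \<open>v\<close>, \<open>fs n\<close> from \<open>v\<close> to the net point, exchange
            of \<open>fs n\<close> for \<open>f\<close> there, and \<open>f\<close> back to
            \<open>v\<close>.\<close>
          have "norm (?z - v s) \<le> ?d" unfolding v_def using norm_Pair_le[of "xs n s - x s"] by simp
          then have 1: "norm (fs n s ?z - fs n s (v s)) \<le> kn s * ?d"
            using ks sT zj vj kn(2)[of s] by (meson mult_left_mono order_trans)
          have uv: "norm (v s - u) \<le> \<eta>" "norm (u - v s) \<le> \<eta>" using u(2) by (auto simp: dist_norm norm_minus_commute)
          have 2: "norm (fs n s (v s) - fs n s u) \<le> kn s * \<eta>"
            using ks sT vj uj kn(2)[of s] uv by (meson mult_left_mono order_trans)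
          have 3: "norm (f s u - f s (v s)) \<le> l s * \<eta>"
            using ls vj uj l0[of s] uv by (meson mult_left_mono order_trans)
          have 4: "norm (fs n s u - f s u) \<le> (\<Sum>u\<in>U. norm (q u s))"
            unfolding q_def using member_le_sum[OF u(1), of "\<lambda>u. norm (fs n s u - f s u)"] U(1) by simp
          have "norm (fs n s ?z - f s (v s)) \<le> kn s * ?d + kn s * \<eta> + (\<Sum>u\<in>U. norm (q u s)) + l s * \<eta>"
            by (rule norm_diff_triangle_le[OF norm_diff_triangle_le[OF norm_diff_triangle_le[OF 1 2] 4] 3])
          also have "\<dots> \<le> k s * ?d + ?h s"
            unfolding k_def using mult_nonneg_nonneg[OF l0[of s], of ?d] by (simp add: algebra_simps)
          finally show "norm (fs n s ?z - f s (x s, x (s - 1))) \<le> k s * ?d + ?h s" unfolding v_def .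
        qed
      qed
    qed
  qed
qed

section \<open>Convergence along equicontinuous curves, case (i)\<close>

text \<open>While the pair of values stays in the ball of radius \<open>j\<close>, the speed of
  \<open>y\<close> is at most the m-bound of \<open>g\<close>, so its oscillation is bounded by the
  integrals that define the modulus. Freezing \<open>y\<close> after \<tau> preserves this and gives
  a curve on the whole rational interval, even if \<open>y\<close> itself leaves the ball or blows
  up.\<close>

lemma clamped_solution_in_modulus_set:
  fixes y :: "real \<Rightarrow> real ^ 'n"
  assumes E: "E \<subseteq> LC" and eq: "L1_loc_equicontinuous_m_bounds E" and g: "g \<in> E"
    and y: "solution_on g \<psi> b y" and \<tau>: "0 \<le> \<tau>" "\<tau> \<le> of_rat q" "ereal \<tau> < b"
    and bnd: "\<And>s. s \<in> {-1..\<tau>} \<Longrightarrow> norm (y s) \<le> R" and R: "2 * R \<le> real j"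
  shows "(\<lambda>t. y (max 0 (min \<tau> t))) \<in> modulus_set (m_moduli E) j 0 q"
proof -
  define cl where "cl = (\<lambda>t. max 0 (min \<tau> t))"
  have cl: "cl t \<in> {0..\<tau>}" for t unfolding cl_def using \<tau> by auto
  have "0 \<le> R" using bnd[of 0] \<tau>(1) by (intro order_trans[OF norm_ge_zero]) auto
  have osc: "norm (y (cl t) - y (cl s)) \<le> m_moduli E j 0 q (t - s)"
    if st: "0 \<le> s" "s \<le> t" "t \<le> of_rat q" for s t
  proof (rule m_bound_le_m_moduli[OF E eq g, of 0 "cl s"])
    \<comment> \<open>Clamping is monotone and does not increase time differences, so the
      integration interval fits into one of length \<open>t - s\<close> starting at
      \<open>cl s\<close>.\<close>
    have le: "cl s \<le> cl t" "cl t \<le> cl s + (t - s)" using st unfolding cl_def by auto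
    have ct: "ereal (cl t) < b" using cl[of t] \<tau>(3) by (auto intro: le_less_trans[of _ "ereal \<tau>"])
    let ?g = "\<lambda>r. g r (y r, y (r - 1))"
    have "?g absolutely_integrable_on {0..\<tau>}" by (rule solution_onD(4)[OF y \<tau>(1,3)])
    then have ai: "?g absolutely_integrable_on {cl s..cl t}"
      using cl[of s] cl[of t] by (auto intro: absolutely_integrable_on_subinterval)
    have "y (cl t) - y (cl s) = integral {cl s..cl t} ?g"
      using cl[of s] by (intro solution_on_diff[OF y ct _ le(1)]) auto
    then have "ennreal (norm (y (cl t) - y (cl s))) \<le> (\<integral>\<^sup>+ r\<in>{cl s..cl t}. ennreal (norm (?g r)) \<partial>lebesgue)"
      using norm_integral_le_nn_integral[OF ai] by simp
    also have "\<dots> \<le> (\<integral>\<^sup>+ r\<in>{cl s..cl s + (t - s)}. m_bound j g r \<partial>lebesgue)"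
    proof (rule nn_integral_mono)
      fix r
      have "ennreal (norm (?g r)) \<le> m_bound j g r" if r: "r \<in> {cl s..cl t}"
      proof -
        have "norm (y r, y (r - 1)) \<le> 2 * R"
          using bnd r cl[of s] cl[of t] by (intro norm_solution_pair_bound[where T = \<tau>]) auto
        then show ?thesis unfolding m_bound_def using R by (intro SUP_upper) simp
      qed
      then show "ennreal (norm (?g r)) * indicator {cl s..cl t} r \<le> m_bound j g r * indicator {cl s..cl s + (t - s)} r"
        using le(2) by (auto split: split_indicator)
    qed
    finally show "ennreal (norm (y (cl t) - y (cl s))) \<le> (\<integral>\<^sup>+ r\<in>{cl s..cl s + (t - s)}. m_bound j g r \<partial>lebesgue)" .
  qed (use st cl[of s] \<tau>(2) in auto)
  have "continuous_on {0..of_rat q} (\<lambda>t. y (cl t))"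
  proof (rule continuous_on_compose2[OF solution_on_continuous_Icc[OF y \<tau>(3)]])
    show "continuous_on {0..of_rat q} cl" unfolding cl_def by (intro continuous_intros)
    show "cl ` {0..of_rat q} \<subseteq> {-1..\<tau>}" unfolding cl_def using \<tau>(1) by auto
  qed
  moreover have "norm (y (cl t)) \<le> real j" for t
    using bnd[of "cl t"] cl[of t] R \<open>0 \<le> R\<close> by force
  moreover have "norm (y (cl t) - y (cl s)) \<le> m_moduli E j 0 q \<bar>t - s\<bar>"
    if "t \<in> {0..of_rat q}" "s \<in> {0..of_rat q}" for t s
    using osc[of s t] osc[of t s] that by (cases "s \<le> t") (auto simp: norm_minus_commute)
  ultimately show ?thesis unfolding modulus_set_def cl_def by auto
qed

text \<open>The first slot needs no net: the seminorms take a supremum over curves there, and the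
  stopped x_n is one of them for every n. So \<open>fs n\<close> is moved only in the delayed slot,
  where its l2-bound applies.\<close>

lemma l2_bounds_imp_defect_bound:
  fixes E :: "(real \<Rightarrow> (real ^ 'n) \<times> (real ^ 'n) \<Rightarrow> real ^ 'n) set"
  assumes E: "E \<subseteq> LC" "\<And>n. fs n \<in> E" and D: "closure D = UNIV"
    and eq: "L1_loc_equicontinuous_m_bounds E" and bdd: "L1_loc_bounded_l2_bounds E"
    and lim: "limitin (T_ThetaD (m_moduli E) D) fs f sequentially"
    and x: "solution_on f \<phi> b x" and T: "0 \<le> T" "ereal T < b"
    and xs: "\<And>n. solution_on (fs n) (\<phi>s n) (bs n) (xs n)"
  obtains C where "\<And>\<epsilon>. \<epsilon> > 0 \<Longrightarrow> \<forall>\<^sub>F n in sequentially. defect_bound T C \<epsilon> f x (fs n) (xs n) (bs n)"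
proof -
  note f = limitin_LC_topology(1)[OF lim[unfolded T_ThetaD_def]]
  have fsLC: "fs n \<in> LC" for n using E by auto
  have cx: "continuous_on {-1..T} x" by (rule solution_on_continuous_Icc[OF x T(2)])
  then have "bounded (x ` {-1..T})" by (intro compact_imp_bounded compact_continuous_image) auto
  then obtain R where "\<forall>y\<in>x ` {-1..T}. norm y \<le> R" unfolding bounded_iff ..
  then have R: "norm (x s) \<le> R" if "s \<in> {-1..T}" for s using that by blast
  obtain j :: nat where j: "2 * (R + 1) \<le> real j" using real_arch_simple by blast
  obtain m l where "\<And>a b. m absolutely_integrable_on {a..b}"
      and l: "\<And>a b. l absolutely_integrable_on {a..b}" and "\<And>t. 0 \<le> m t" and l0: "\<And>t. 0 \<le> l t"
      and lae: "AE t in lebesgue. (\<forall>z\<in>cball 0 (real j). norm (f t z) \<le> m t) \<and>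
        (\<forall>z1\<in>cball 0 (real j). \<forall>z2\<in>cball 0 (real j). norm (f t z1 - f t z2) \<le> l t * norm (z1 - z2))"
    by (rule LC_bounds[OF f compact_cball[of 0 "real j"]]) (rule that)
  obtain C0 where C0: "0 \<le> C0" "\<And>g. g \<in> E \<Longrightarrow> (\<integral>\<^sup>+ t\<in>{0..T}. l2_bound j g t \<partial>lebesgue) \<le> ennreal C0"
    by (rule uniform_bound_on_subinterval[OF bdd[unfolded L1_loc_bounded_l2_bounds_def, rule_format, of _ j] T(1)])
      (auto intro: that)
  define C where "C = C0 + integral {0..T} l"
  have "0 \<le> integral {0..T} l"
    using l l0 by (intro Henstock_Kurzweil_Integration.integral_nonneg) (auto simp: absolutely_integrable_on_def)
  then have C: "0 \<le> C" using C0 unfolding C_def by simp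
  \<comment> \<open>Only the delayed value of the limit solution is approximated by the net.\<close>
  define v where "v = (\<lambda>s. x (s - 1))"
  have v: "norm (v s) \<le> R" if "s \<in> {0..T}" for s
    unfolding v_def using that R by auto
  have "continuous_on {0..T} v"
    unfolding v_def by (intro continuous_on_compose2[OF cx] continuous_intros) auto
  then have cv: "compact (v ` {0..T})" by (intro compact_continuous_image) auto
  show thesis
  proof (rule that[of C])
    fix \<epsilon> :: real assume \<epsilon>: "\<epsilon> > 0"
    obtain \<eta> where \<eta>: "0 < \<eta>" "\<eta> \<le> 1" "C * \<eta> \<le> \<epsilon> / 2" by (rule exists_net_parameters[OF \<epsilon> C])
    obtain U where U: "finite U" "U \<subseteq> D" "\<And>z. z \<in> v ` {0..T} \<Longrightarrow> \<exists>u\<in>U. dist z u < \<eta>"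
      by (rule finite_net_of_dense[OF cv D \<eta>(1)]) (rule that)
    define \<delta> where "\<delta> = \<epsilon> / (2 * (real (card U) + 1))"
    have \<delta>: "0 < \<delta>" "real (card U) * \<delta> \<le> \<epsilon> / 2"
      using \<epsilon> unfolding \<delta>_def by (auto simp: field_simps add_pos_nonneg)
    define q2 where "q2 = (of_nat (nat \<lceil>T\<rceil>) :: rat)"
    have q2: "T \<le> of_rat q2" "0 \<le> q2" unfolding q2_def by (auto simp: real_nat_ceiling_ge)
    have "\<forall>\<^sub>F n in sequentially. seminorm_ThetaD (m_moduli E) j 0 q2 u (\<lambda>t z. fs n t z - f t z) < ennreal \<delta>"
      if "u \<in> U" for u
    proof (rule limitin_LC_topology(2)[OF lim[unfolded T_ThetaD_def] _ _ \<delta>(1)])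
      show "seminorm_ThetaD (m_moduli E) j 0 q2 u \<in>
          {seminorm_ThetaD (m_moduli E) j q1 q2 u | j q1 q2 u. q1 \<le> q2 \<and> u \<in> D}"
        using that U(2) q2 by blast
      show "seminorm_ThetaD (m_moduli E) j 0 q2 u (\<lambda>t z. 0) = 0"
        unfolding seminorm_ThetaD_def by (auto intro!: antisym SUP_least)
    qed
    then have "\<forall>\<^sub>F n in sequentially.
        \<forall>u\<in>U. seminorm_ThetaD (m_moduli E) j 0 q2 u (\<lambda>t z. fs n t z - f t z) < ennreal \<delta>"
      by (intro eventually_ball_finite U) auto
    then show "\<forall>\<^sub>F n in sequentially. defect_bound T C \<epsilon> f x (fs n) (xs n) (bs n)"
    proof eventually_elim
      case (elim n)
      obtain kn where kn: "kn absolutely_integrable_on {0..T}" "\<And>t. 0 \<le> kn t" "integral {0..T} kn \<le> C0"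
        and kae: "AE t in lebesgue. t \<in> {0..T} \<longrightarrow> (\<forall>x u1 u2. (x, u1) \<in> cball 0 (real j) \<longrightarrow>
            (x, u2) \<in> cball 0 (real j) \<longrightarrow> norm (fs n t (x, u1) - fs n t (x, u2)) \<le> kn t * norm (u1 - u2))"
        by (rule l2_bound_kernel[OF fsLC _ C0(2)[OF E(2)] C0(1)]) (auto intro: that)
      define k where "k = (\<lambda>t. kn t + l t)"
      have k: "k absolutely_integrable_on {0..T}" "\<And>s. 0 \<le> k s"
        unfolding k_def using kn l l0 by (auto intro: set_integral_add(1))
      have "integral {0..T} k = integral {0..T} kn + integral {0..T} l"
        unfolding k_def using kn(1) l[of 0 T]
        by (intro Henstock_Kurzweil_Integration.integral_add) (auto simp: absolutely_integrable_on_def)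
      then have kC: "integral {0..T} k \<le> C" using kn(3) unfolding C_def by simp
      have xn: "norm (xs n r) \<le> R + 1"
        if "\<tau> \<le> T" "\<forall>s\<in>{-1..\<tau>}. norm (xs n s - x s) \<le> 1" "r \<in> {-1..\<tau>}" for \<tau> r
        using norm_triangle_ineq[of "x r" "xs n r - x r"] R[of r] that by force
      \<comment> \<open>The default 0 makes the curve measurable for every \<tau>, also where x_n is
        not defined up to \<tau>; for admissible \<tau> it is the stopped solution.\<close>
      define z where "z = (\<lambda>\<tau> t. if 0 \<le> \<tau> \<and> ereal \<tau> < bs n then xs n (max 0 (min \<tau> t)) else 0)"
      define q where "q = (\<lambda>\<tau> u t. fs n t (z \<tau> t, u) - f t (z \<tau> t, u))"
      have zb: "z \<tau> \<in> borel_measurable borel" for \<tau>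
      proof (cases "0 \<le> \<tau> \<and> ereal \<tau> < bs n")
        case True
        then have "continuous_on UNIV (\<lambda>t. xs n (max 0 (min \<tau> t)))"
          by (intro continuous_on_compose2[OF solution_on_continuous_Icc[OF xs, of \<tau>]] continuous_intros) auto
        with True show ?thesis unfolding z_def by (auto intro: borel_measurable_continuous_onI)
      next
        case False
        then show ?thesis unfolding z_def by (simp only: if_False borel_measurable_const)
      qed
      have q: "q \<tau> u \<in> borel_measurable lebesgue" if "u \<in> U" for \<tau> u
        unfolding q_def using f fsLC[of n] zb[of \<tau>]
        by (intro borel_measurable_diff LC_compose_lebesgue borel_measurable_Pair) auto
      show ?case
      proof (rule defect_boundI[where q = q, OF T(1) q2(1) k kC U(1) less_imp_le[OF \<eta>(1)] less_imp_le[OF \<delta>(1)] _ q])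
        show "C * \<eta> + real (card U) * \<delta> \<le> \<epsilon>" using \<eta>(3) \<delta>(2) by linarith
      next
        fix \<tau> u assume \<tau>: "0 \<le> \<tau>" "\<tau> \<le> T" "ereal \<tau> < bs n" and d1: "\<forall>s\<in>{-1..\<tau>}. norm (xs n s - x s) \<le> 1"
          and u: "u \<in> U"
        have "z \<tau> = (\<lambda>t. xs n (max 0 (min \<tau> t)))" unfolding z_def using \<tau> by simp
        then have zmod: "z \<tau> \<in> modulus_set (m_moduli E) j 0 q2"
          using clamped_solution_in_modulus_set[OF E(1) eq E(2) xs \<tau>(1) _ \<tau>(3) xn[OF \<tau>(2) d1] j, of q2] \<tau> q2
          by simp
        have "(\<integral>\<^sup>+ t\<in>{0..of_rat q2}. ennreal (norm (q \<tau> u t)) \<partial>lebesgue) \<le>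
            seminorm_ThetaD (m_moduli E) j 0 q2 u (\<lambda>t z. fs n t z - f t z)"
          unfolding seminorm_ThetaD_def q_def by (rule SUP_upper2[OF zmod]) simp
        also have "\<dots> \<le> ennreal \<delta>" using elim u by (simp add: less_imp_le)
        finally show "(\<integral>\<^sup>+ t\<in>{0..of_rat q2}. ennreal (norm (q \<tau> u t)) \<partial>lebesgue) \<le> ennreal \<delta>" .
      next
        fix \<tau> assume \<tau>: "0 \<le> \<tau>" "\<tau> \<le> T" "ereal \<tau> < bs n" and d1: "\<forall>s\<in>{-1..\<tau>}. norm (xs n s - x s) \<le> 1"
        let ?h = "\<lambda>s. k s * \<eta> + (\<Sum>u\<in>U. norm (q \<tau> u s))"
        show "AE s in lebesgue. s \<in> {0..\<tau>} \<longrightarrow>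
             norm (fs n s (xs n s, xs n (s - 1)) - f s (x s, x (s - 1)))
               \<le> k s * (norm (xs n s - x s) + norm (xs n (s - 1) - x (s - 1))) + ?h s"
          using lae kae
        proof (eventually_elim, intro impI)
          fix s assume s: "s \<in> {0..\<tau>}"
            and ls: "(\<forall>z\<in>cball 0 (real j). norm (f s z) \<le> m s) \<and>
              (\<forall>z1\<in>cball 0 (real j). \<forall>z2\<in>cball 0 (real j). norm (f s z1 - f s z2) \<le> l s * norm (z1 - z2))"
            and ks: "s \<in> {0..T} \<longrightarrow> (\<forall>x u1 u2. (x, u1) \<in> cball 0 (real j) \<longrightarrow> (x, u2) \<in> cball 0 (real j) \<longrightarrow>
              norm (fs n s (x, u1) - fs n s (x, u2)) \<le> kn s * norm (u1 - u2))"
          have sT: "s \<in> {0..T}" using s \<tau> by auto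
          obtain u where u: "u \<in> U" "dist (v s) u < \<eta>" using U(3) sT by blast
          have nu: "norm u \<le> R + 1"
            using norm_triangle_ineq2[of u "v s"] v[OF sT] u(2) \<eta>(2) by (simp add: dist_norm norm_minus_commute)
          have inj: "(p, w) \<in> cball 0 (real j)" if "norm p \<le> R + 1" "norm w \<le> R + 1" for p w :: "real ^ 'n"
            using norm_Pair_le[of p w] that j by simp
          have xs1: "norm (xs n s) \<le> R + 1" "norm (xs n (s - 1)) \<le> R + 1" using xn[OF \<tau>(2) d1] s by auto
          have vs: "norm (v s) \<le> R + 1" "norm (x s) \<le> R + 1" using v[OF sT] R[of s] sT by auto
          have zs: "z \<tau> s = xs n s" using s \<tau> unfolding z_def by simp
          have uv: "norm (v s - u) \<le> \<eta>" "norm (u - v s) \<le> \<eta>" using u(2) by (auto simp: dist_norm norm_minus_commute)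
          \<comment> \<open>Five moves: \<open>fs n\<close> to the delayed value \<open>v s\<close>
            and on to the net point, exchange of \<open>fs n\<close> for \<open>f\<close> at the
            moving first component, \<open>f\<close> back to \<open>v s\<close>, and last
            \<open>f\<close> from the first component of x_n to that of \<open>x\<close>. The last
            two use the Lipschitz bound of \<open>f\<close>.\<close>
          have 1: "norm (fs n s (xs n s, xs n (s - 1)) - fs n s (xs n s, v s)) \<le> kn s * norm (xs n (s - 1) - v s)"
            using ks sT inj xs1 vs by blast
          have "norm (fs n s (xs n s, v s) - fs n s (xs n s, u)) \<le> kn s * norm (v s - u)"
            using ks sT inj xs1 vs nu by blast
          then have 2: "norm (fs n s (xs n s, v s) - fs n s (xs n s, u)) \<le> kn s * \<eta>"
            using mult_left_mono[OF uv(1) kn(2)[of s]] by linarith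
          have 3: "norm (fs n s (xs n s, u) - f s (xs n s, u)) \<le> (\<Sum>u\<in>U. norm (q \<tau> u s))"
            using member_le_sum[OF u(1), of "\<lambda>u. norm (q \<tau> u s)"] U(1) unfolding q_def zs by simp
          have "norm (f s (xs n s, u) - f s (xs n s, v s)) \<le> l s * norm ((xs n s, u) - (xs n s, v s))"
            using ls inj xs1 vs nu by blast
          then have 4: "norm (f s (xs n s, u) - f s (xs n s, v s)) \<le> l s * \<eta>"
            using mult_left_mono[OF uv(2) l0[of s]] by (simp add: norm_Pair)
          have "norm (f s (xs n s, v s) - f s (x s, v s)) \<le> l s * norm ((xs n s, v s) - (x s, v s))"
            using ls inj xs1 vs by blast
          then have 5: "norm (f s (xs n s, v s) - f s (x s, v s)) \<le> l s * norm (xs n s - x s)"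
            by (simp add: norm_Pair)
          have "norm (fs n s (xs n s, xs n (s - 1)) - f s (x s, v s)) \<le> kn s * norm (xs n (s - 1) - v s) +
              kn s * \<eta> + (\<Sum>u\<in>U. norm (q \<tau> u s)) + l s * \<eta> + l s * norm (xs n s - x s)"
            by (rule norm_diff_triangle_le[OF norm_diff_triangle_le[OF norm_diff_triangle_le[OF
                norm_diff_triangle_le[OF 1 2] 3] 4] 5])
          also have "\<dots> \<le> k s * (norm (xs n s - x s) + norm (xs n (s - 1) - v s)) + ?h s"
            unfolding k_def
            using mult_nonneg_nonneg[OF l0[of s] norm_ge_zero[of "xs n (s - 1) - v s"]]
              mult_nonneg_nonneg[OF kn(2)[of s] norm_ge_zero[of "xs n s - x s"]]
            by (simp add: algebra_simps)
          finally show "norm (fs n s (xs n s, xs n (s - 1)) - f s (x s, x (s - 1)))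
               \<le> k s * (norm (xs n s - x s) + norm (xs n (s - 1) - x (s - 1))) + ?h s" unfolding v_def .
        qed
      qed
    qed
  qed
qed

text \<open>On \<open>{-1..0}\<close> the solutions are the initial functions, and uniform
  convergence of these does not control their derivatives. Hence the derivatives converge on
  \<open>{0..T}\<close> in any case, and on all of \<open>{-1..T}\<close> when the initial functions
  converge in the \<open>C11\<close> norm.\<close>

theorem theorem4p6:
  fixes E :: "(real \<Rightarrow> (real ^ 'n) \<times> (real ^ 'n) \<Rightarrow> real ^ 'n) set"
    and D' :: "(real ^ 'n) set"
    and D :: "((real ^ 'n) \<times> (real ^ 'n)) set"
    and fs :: "nat \<Rightarrow> real \<Rightarrow> (real ^ 'n) \<times> (real ^ 'n) \<Rightarrow> real ^ 'n"
    and f :: "real \<Rightarrow> (real ^ 'n) \<times> (real ^ 'n) \<Rightarrow> real ^ 'n"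
    and \<phi>s :: "nat \<Rightarrow> real \<Rightarrow> real ^ 'n"
    and \<phi> :: "real \<Rightarrow> real ^ 'n"
    and xs :: "nat \<Rightarrow> real \<Rightarrow> real ^ 'n"
    and x :: "real \<Rightarrow> real ^ 'n"
    and bs :: "nat \<Rightarrow> ereal"
    and b :: ereal
    and T :: real
  assumes "E \<subseteq> LC"
    and "countable D'" "closure D' = UNIV"
    and "countable D" "closure D = UNIV"
    and "\<And>n. fs n \<in> E"
    and "\<And>n. \<phi>s n \<in> C11 {-1..0}" "\<phi> \<in> C11 {-1..0}"
    and "uniform_limit {-1..0} \<phi>s \<phi> sequentially"
    and "\<And>n. maximal_solution (fs n) (\<phi>s n) (bs n) (xs n)"
    and "maximal_solution f \<phi> b x"
    and "-1 \<le> T" "ereal T < b"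
  defines "conclusion \<equiv>
      (\<forall>\<^sub>F n in sequentially. ereal T < bs n) \<and>
      uniform_limit {-1..T} xs x sequentially \<and>
      C11_tendsto {0..T} xs x \<and>
      (C11_tendsto {-1..0} \<phi>s \<phi> \<longrightarrow> C11_tendsto {-1..T} xs x)"
  shows "(L1_loc_equicontinuous_m_bounds E \<and> L1_loc_bounded_l2_bounds E \<and>
            limitin (T_ThetaD (m_moduli E) D') fs f sequentially \<longrightarrow> conclusion) \<and>
         (L1_loc_bounded_l_bounds E \<and>
            limitin (T_D D) fs f sequentially \<longrightarrow> conclusion)"
proof -
  note E = assms(1,6) and Ddense = assms(3,5) and T = assms(12,13)
  have xsol: "solution_on f \<phi> b x" and xssol: "\<And>n. solution_on (fs n) (\<phi>s n) (bs n) (xs n)"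
    using assms(10,11) unfolding maximal_solution_def by blast+
  have fsLC: "fs n \<in> LC" for n using E by auto
  have initial: "C11_tendsto {-1..0} xs x" if "C11_tendsto {-1..0} \<phi>s \<phi>"
    using that by (rule C11_tendsto_cong_Icc) (use solution_onD(3)[OF xsol] solution_onD(3)[OF xssol] in auto)
  have concl: "conclusion"
    if est: "\<lbrakk>0 \<le> T\<rbrakk> \<Longrightarrow> \<exists>C. \<forall>\<epsilon>>0. \<forall>\<^sub>F n in sequentially. defect_bound T C \<epsilon> f x (fs n) (xs n) (bs n)"
  proof (cases "0 \<le> T")
    case True
    then obtain C where C: "\<And>\<epsilon>. \<epsilon> > 0 \<Longrightarrow> \<forall>\<^sub>F n in sequentially. defect_bound T C \<epsilon> f x (fs n) (xs n) (bs n)"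
      using est by blast
    have *: "(\<forall>\<^sub>F n in sequentially. ereal T < bs n) \<and> uniform_limit {-1..T} xs x sequentially \<and>
        C11_tendsto {0..T} xs x"
      by (rule solutions_C11_tendsto[OF xssol xsol True T(2)])
        (rule solution_sequence_stability[OF fsLC assms(10) xsol True T(2) assms(9) C])
    then show ?thesis
      unfolding conclusion_def using C11_tendsto_union[OF initial, of T] True by auto
  next
    \<comment> \<open>For negative \<open>T\<close> no dynamics is involved: every maximal interval
      reaches beyond 0, and the claims concern the initial functions only.\<close>
    case False
    have "ereal T < bs n" for n
      using solution_onD(1)[OF xssol[of n]] False by (auto intro: less_trans[of _ 0])
    moreover have "uniform_limit {-1..T} xs x sequentially"
    proof (rule uniform_limitI)
      fix e :: real assume "e > 0"
      from uniform_limitD[OF assms(9) this]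
      show "\<forall>\<^sub>F n in sequentially. \<forall>t\<in>{-1..T}. dist (xs n t) (x t) < e"
        by eventually_elim (use False solution_onD(3)[OF xsol] solution_onD(3)[OF xssol] in auto)
    qed
    \<comment> \<open>The interval is empty, so the supremum is the bottom element 0 and the norm
      vanishes.\<close>
    moreover have "C11_tendsto {0..T} xs x"
      using False unfolding C11_tendsto_def C11_def C11_norm_def by (simp add: bot_ennreal)
    moreover have "C11_tendsto {-1..T} xs x" if "C11_tendsto {-1..0} \<phi>s \<phi>"
      using C11_tendsto_subinterval[OF initial[OF that], of "-1" T] False by auto
    ultimately show ?thesis unfolding conclusion_def by auto
  qed
  show ?thesis
  proof (intro conjI impI)
    assume *: "L1_loc_equicontinuous_m_bounds E \<and> L1_loc_bounded_l2_bounds E \<and>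
            limitin (T_ThetaD (m_moduli E) D') fs f sequentially"
    show conclusion
      by (rule concl, rule l2_bounds_imp_defect_bound[where fs = fs and xs = xs and bs = bs,
          OF E Ddense(1) conjunct1[OF *] conjunct1[OF conjunct2[OF *]] conjunct2[OF conjunct2[OF *]] xsol _ T(2) xssol])
        blast+
  next
    assume *: "L1_loc_bounded_l_bounds E \<and> limitin (T_D D) fs f sequentially"
    show conclusion
      by (rule concl, rule l_bounds_imp_defect_bound[where fs = fs and xs = xs and bs = bs,
          OF E Ddense(2) conjunct1[OF *] conjunct2[OF *] xsol _ T(2)])
        blast+
  qed
qed

end
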